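(* Let $p$ be an odd prime and $r\in\mathbb{N}$. Let $\chi$ be a primitive Dirichlet character of odd conductor $f$, with values regarded in $\mathbb{C}_p$, and let $F$ be an odd positive integer that is a common multiple of $p$ and $f$. Define, for $s\in D=\{s\in\mathbb{C}_p : |s|_p<p^{1-\frac{1}{p-1}}\}$, $$ l_{p,r}(s,\chi)=\sum_{\substack{a_1,\dots,a_r=1\\ p\nmid a_1+\cdots+a_r}}^{F}\chi(a_1+\cdots+a_r)\,\langle a_1+\cdots+a_r\rangle^{-s}\,(-1)^{a_1+\cdots+a_r}\sum_{m=0}^{\infty}\binom{-s}{m}\left(\frac{F}{a_1+\cdots+a_r}\right)^{m}E_m^{(r)} .$$ Then $l_{p,r}(s,\chi)$ is analytic on $D$, and for every $n\in\mathbb{N}$, $$ l_{p,r}(-n,\chi)=E^{(r)}_{n,\chi_n}-p^{n}\chi_n(p)\,E^{*(r)}_{n,\chi_n}. $$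
   Context: $\mathbb{C}_p$ is the completion of an algebraic closure of $\mathbb{Q}_p$, with $|p|_p=p^{-1}$. For $r\in\mathbb{N}$, the multiple Euler numbers $E_m^{(r)}$ and polynomials $E_m^{(r)}(x)$ are defined by $\left(\frac{2}{e^t+1}\right)^r=\sum_{m\ge0}E_m^{(r)}\frac{t^m}{m!}$ and $\left(\frac{2}{e^t+1}\right)^r e^{xt}=\sum_{m\ge0}E_m^{(r)}(x)\frac{t^m}{m!}$ (they are rational numbers, regarded in $\mathbb{Q}_p$). $w$ denotes the Teichmüller character (conductor $p$): for $p\nmid a$, $w(a)$ is the unique $(p-1)$-st root of unity in $\mathbb{Z}_p$ congruent to $a$ mod $p$; for $p\nmid a$ put $\langle a\rangle=a/w(a)\in 1+p\mathbb{Z}_p$, and $\langle a\rangle^{-s}=\exp_p(-s\log_p\langle a\rangle)$. For $n\in\mathbb{Z}$, $\chi_n$ denotes the primitive Dirichlet character associated with the product $\chi w^{-n}$; its conductor divides $fp$, hence divides $F$. For $n\in\mathbb{N}$ set $A=a_1+\cdots+a_r$ and $$E^{(r)}_{n,\chi_n}=F^n\sum_{a_1,\dots,a_r=1}^{F}\chi_n(A)(-1)^{A}E_n^{(r)}\!\left(\frac{A}{F}\right),$$ (equivalently, $2^r\sum_{a_1,\dots,a_r=1}^{F}\frac{(-1)^{A}\chi_n(A)e^{At}}{(e^{Ft}+1)^r}=\sum_{n\ge0}E^{(r)}_{n,\chi_n}\frac{t^n}{n!}$), and $$E^{*(r)}_{n,\chi_n}=\left(\frac{F}{p}\right)^n\sum_{\substack{a_1,\dots,a_r=1\\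 p\mid A}}^{F}\chi_n\!\left(\frac{A}{p}\right)(-1)^{A/p}E_n^{(r)}\!\left(\frac{A/p}{F/p}\right).$$ *)

theory Defs
  imports
    "HOL-Analysis.Analysis"
    "HOL-Computational_Algebra.Computational_Algebra"
    "HOL-Number_Theory.Cong"
begin

section \<open>The field of p-adic complex numbers\<close>

text \<open>
  The type class \<open>real_normed_field\<close> is unusable for p-adic fields, so the absolute value
  is taken to be the distance to 0 in a metric on the field.
\<close>

definition padic_abs :: "'a::{zero,metric_space} \<Rightarrow> real" where
  "padic_abs x = dist x 0"

definition Qp :: "'a::{field_char_0,metric_space} set" where
  "Qp = closure \<rat>"

definition Zp :: "'a::{field_char_0,metric_space} set" where
  "Zp = {x \<in> Qp. padic_abs x \<le> 1}"

definition Qp_bar :: "'a::{field_char_0,metric_space} set" where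
  "Qp_bar = {x. \<exists>q. q \<noteq> 0 \<and> (\<forall>i. coeff q i \<in> Qp) \<and> poly q x = 0}"

text \<open>
  The type \<open>'a\<close> is a completion of an algebraic closure of the field of p-adic numbers.
  Completeness of \<open>'a\<close> comes from its class \<open>complete_space\<close>; since \<open>p\<close> is prime, the
  metric conditions force the metric to be the p-adic one on the rationals, so the closure
  \<open>Qp\<close> of the rationals is their p-adic completion; \<open>Qp_bar\<close> is algebraic over \<open>Qp\<close> by
  definition, is required to be algebraically closed, and is required to be dense.
  These conditions determine \<open>'a\<close> up to isometric isomorphism.
\<close>

definition is_padic_complex :: "'a::{field_char_0,complete_space} itself \<Rightarrow> nat \<Rightarrow> bool" where
  "is_padic_complex (_ :: 'a itself) p \<longleftrightarrow>
     prime p \<and>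
     (\<forall>x y :: 'a. dist x y = padic_abs (x - y)) \<and>
     (\<forall>x y :: 'a. padic_abs (x * y) = padic_abs x * padic_abs y) \<and>
     (\<forall>x y :: 'a. padic_abs (x + y) \<le> max (padic_abs x) (padic_abs y)) \<and>
     padic_abs (of_nat p :: 'a) = 1 / real p \<and>
     (\<forall>q :: 'a poly. degree q > 0 \<and> (\<forall>i. coeff q i \<in> Qp_bar) \<longrightarrow>
        (\<exists>x\<in>Qp_bar. poly q x = 0)) \<and>
     closure (Qp_bar :: 'a set) = UNIV"

definition exp_p :: "'a::{field_char_0,metric_space} \<Rightarrow> 'a" where
  "exp_p x = (\<Sum>n. x ^ n / fact n)"

definition log_p :: "'a::{field_char_0,metric_space} \<Rightarrow> 'a" where
  "log_p x = (\<Sum>n. (-1) ^ n * (x - 1) ^ Suc n / of_nat (Suc n))"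

text \<open>Analyticity on an open disc means expansion in one power series converging on the
  whole disc; discs in an ultrametric field are totally disconnected, so a merely local
  condition would be much weaker.\<close>

definition analytic_on_disc ::
    "('a::{field_char_0,metric_space} \<Rightarrow> 'a) \<Rightarrow> real \<Rightarrow> bool" where
  "analytic_on_disc g R \<longleftrightarrow>
     (\<exists>c. \<forall>s. padic_abs s < R \<longrightarrow> (\<lambda>k. c k * s ^ k) sums g s)"

definition radius_D :: "nat \<Rightarrow> real" where
  "radius_D p = real p powr (1 - 1 / (real p - 1))"


section \<open>Dirichlet characters\<close>

definition dirichlet_character :: "nat \<Rightarrow> (int \<Rightarrow> 'a::field) \<Rightarrow> bool" where
  "dirichlet_character N chi \<longleftrightarrow>
     N > 0 \<and> chi 1 = 1 \<and>
     (\<forall>a b. chi (a * b) = chi a * chi b) \<and>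
     (\<forall>a. chi (a + int N) = chi a) \<and>
     (\<forall>a. chi a = 0 \<longleftrightarrow> \<not> coprime a (int N))"

text \<open>A character modulo \<open>N\<close> has conductor \<open>N\<close> iff it is not induced from a modulus that is
  a proper divisor \<open>d\<close> of \<open>N\<close>, i.e. it is nontrivial on the units congruent to 1 modulo \<open>d\<close>.\<close>

definition primitive_character :: "nat \<Rightarrow> (int \<Rightarrow> 'a::field) \<Rightarrow> bool" where
  "primitive_character N chi \<longleftrightarrow>
     dirichlet_character N chi \<and>
     (\<forall>d. d dvd N \<and> d < N \<longrightarrow>
        (\<exists>a. coprime a (int N) \<and> [a = 1] (mod int d) \<and> chi a \<noteq> 1))"

definition associated_primitive :: "nat \<Rightarrow> (int \<Rightarrow> 'a::field) \<Rightarrow> int \<Rightarrow> 'a" where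
  "associated_primitive M \<eta> =
     (THE \<psi>. (\<exists>d. d dvd M \<and> primitive_character d \<psi>) \<and>
             (\<forall>a. coprime a (int M) \<longrightarrow> \<psi> a = \<eta> a))"

definition teichmueller :: "nat \<Rightarrow> int \<Rightarrow> 'a::{field_char_0,metric_space}" where
  "teichmueller p a =
     (if int p dvd a then 0
      else (THE x. x \<in> Zp \<and> x ^ (p - 1) = 1 \<and> (\<exists>y\<in>Zp. x - of_int a = of_nat p * y)))"

definition angle :: "nat \<Rightarrow> int \<Rightarrow> 'a::{field_char_0,metric_space}" where
  "angle p a = of_int a / teichmueller p a"

definition angle_pow :: "nat \<Rightarrow> int \<Rightarrow> 'a::{field_char_0,metric_space} \<Rightarrow> 'a" where
  "angle_pow p a s = exp_p (s * log_p (angle p a))"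

text \<open>The primitive character attached to \<open>chi\<close> times the \<open>-n\<close>-th power of the Teichmueller
  character, where \<open>f\<close> is the conductor of \<open>chi\<close>.\<close>

definition twist ::
    "nat \<Rightarrow> nat \<Rightarrow> (int \<Rightarrow> 'a::{field_char_0,metric_space}) \<Rightarrow> int \<Rightarrow> int \<Rightarrow> 'a" where
  "twist p f chi n = associated_primitive (f * p)
     (\<lambda>a. chi a * (if int p dvd a then 0 else teichmueller p a powi (- n)))"


section \<open>Multiple Euler numbers and polynomials\<close>

definition euler_number :: "nat \<Rightarrow> nat \<Rightarrow> rat" where
  "euler_number r m = fact m * fps_nth ((2 / (fps_exp 1 + 1)) ^ r) m"

definition euler_polynomial :: "nat \<Rightarrow> nat \<Rightarrow> rat \<Rightarrow> rat" where
  "euler_polynomial r m x = fact m * fps_nth ((2 / (fps_exp 1 + 1)) ^ r * fps_exp x) m"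

definition tuples :: "nat \<Rightarrow> nat \<Rightarrow> (nat \<Rightarrow> nat) set" where
  "tuples r F = {..<r} \<rightarrow>\<^sub>E {1..F}"

definition generalized_euler ::
    "nat \<Rightarrow> nat \<Rightarrow> nat \<Rightarrow> (int \<Rightarrow> 'a::field_char_0) \<Rightarrow> 'a" where
  "generalized_euler r F n \<psi> =
     of_nat F ^ n *
     (\<Sum>a\<in>tuples r F. let A = (\<Sum>i<r. a i) in
        \<psi> (int A) * (-1) ^ A * of_rat (euler_polynomial r n (of_nat A / of_nat F)))"

definition generalized_euler_star ::
    "nat \<Rightarrow> nat \<Rightarrow> nat \<Rightarrow> nat \<Rightarrow> (int \<Rightarrow> 'a::field_char_0) \<Rightarrow> 'a" where
  "generalized_euler_star p r F n \<psi> =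
     (of_nat F / of_nat p) ^ n *
     (\<Sum>a\<in>{a \<in> tuples r F. p dvd (\<Sum>i<r. a i)}. let A = (\<Sum>i<r. a i) in
        \<psi> (int (A div p)) * (-1) ^ (A div p) *
        of_rat (euler_polynomial r n ((of_nat A / of_nat p) / (of_nat F / of_nat p))))"


section \<open>The multiple p-adic l-function\<close>

definition l_term ::
    "nat \<Rightarrow> nat \<Rightarrow> nat \<Rightarrow> 'a::field_char_0 \<Rightarrow> nat \<Rightarrow> 'a" where
  "l_term r F A s m =
     ((- s) gchoose m) * (of_nat F / of_nat A) ^ m * of_rat (euler_number r m)"

definition l_function ::
    "nat \<Rightarrow> nat \<Rightarrow> nat \<Rightarrow> (int \<Rightarrow> 'a::{field_char_0,metric_space}) \<Rightarrow> 'a \<Rightarrow> 'a" where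
  "l_function p r F chi s =
     (\<Sum>a\<in>{a \<in> tuples r F. \<not> p dvd (\<Sum>i<r. a i)}. let A = (\<Sum>i<r. a i) in
        chi (int A) * angle_pow p (int A) (- s) * (-1) ^ A * (\<Sum>m. l_term r F A s m))"

end

theory Submission
  imports Defs "HOL-Number_Theory.Residues"
begin

text \<open>
  For \<open>p\<close> not dividing \<open>A\<close> and dividing \<open>F\<close>, the \<open>m\<close>-th summand of the inner series is a
  polynomial in \<open>s\<close> whose coefficients are bounded by \<open>p ^ (m / (p - 1) - m)\<close>, because the Euler
  numbers are \<open>p\<close>-integral for odd \<open>p\<close> and \<open>1 / fact m\<close> is at most \<open>p ^ (m / (p - 1))\<close>; the same
  bound governs the exponential series. On the disc an ultrametric Fubini theorem therefore
  rearranges everything into one power series. At \<open>s = - n\<close> the inner series terminates and the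
  formal identity \<open>exp (n * ln (1 + X)) = (1 + X) ^ n\<close> turns the angle power into \<open>A ^ n\<close> divided by
  the \<open>n\<close>-th power of the Teichmueller representative, so the value is the part of the generalized
  Euler number with \<open>p\<close> not dividing \<open>A\<close>; the omitted part is the starred term because the
  twisted character is multiplicative.
\<close>

text \<open>The type carries only a metric, so the limit laws must first be derived from the
  ultrametric axioms. Null terms then suffice for convergence, and the real issue is the order of
  two summations. It arises three times: in the Cauchy product, when one power series is substituted
  into another, and when the inner series is regrouped by powers of \<open>s\<close>. Each time it
  is settled by one criterion: a bound uniform along each row that tends to 0, together with null
  rows. The delicate algebraic point is that \<open>twist\<close> is the primitive character of a
  product. It may be nonzero at multiples of \<open>p\<close>, which is what the starred term
  records. At arguments prime to \<open>p\<close> that share a factor with \<open>f\<close> it must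
  vanish as \<open>chi\<close> does. This means that twisting by a character modulo \<open>p\<close>
  removes no other prime from the conductor, and here the primitivity of \<open>chi\<close>
  enters.\<close>

no_notation vec_nth (infixl "$" 90)
notation padic_abs ("\<bar>_\<bar>\<^sub>p")

section \<open>Series in complete ultrametric fields\<close>

text \<open>Evaluation of formal series is multiplicative up to convergence. Both the summation and
  the size estimates for products rest on this form.\<close>

lemma fps_mult_nth_power:
  fixes y :: "'a::comm_ring_1"
  shows "(f * g) $ k * y ^ k = (\<Sum>i=0..k. (f $ i * y ^ i) * (g $ (k - i) * y ^ (k - i)))"
  unfolding fps_mult_nth sum_distrib_right
proof (rule sum.cong)
  fix i assume "i \<in> {0..k}"
  then have "y ^ k = y ^ i * y ^ (k - i)"
    by (simp flip: power_add)
  then show "f $ i * g $ (k - i) * y ^ k = f $ i * y ^ i * (g $ (k - i) * y ^ (k - i))"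
    by (simp add: mult_ac)
qed simp

locale ultrametric_field =
  fixes type :: "'a::{field_char_0,complete_space} itself"
  assumes dist_eq_padic_abs: "dist (x::'a) y = \<bar>x - y\<bar>\<^sub>p"
    and padic_abs_mult: "\<bar>x * y :: 'a\<bar>\<^sub>p = \<bar>x\<bar>\<^sub>p * \<bar>y\<bar>\<^sub>p"
    and padic_abs_add: "\<bar>x + y :: 'a\<bar>\<^sub>p \<le> max \<bar>x\<bar>\<^sub>p \<bar>y\<bar>\<^sub>p"
begin

lemma padic_abs_nonneg [simp]: "0 \<le> \<bar>x::'a\<bar>\<^sub>p"
  by (simp add: padic_abs_def)

lemma padic_abs_zero [simp]: "\<bar>0::'a\<bar>\<^sub>p = 0"
  by (simp add: padic_abs_def)

lemma padic_abs_eq_0_iff [simp]: "\<bar>x::'a\<bar>\<^sub>p = 0 \<longleftrightarrow> x = 0"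
  by (simp add: padic_abs_def)

lemma padic_abs_one [simp]: "\<bar>1::'a\<bar>\<^sub>p = 1"
  using padic_abs_mult[of 1 1] by simp

lemma padic_abs_power: "\<bar>x ^ n :: 'a\<bar>\<^sub>p = \<bar>x\<bar>\<^sub>p ^ n"
  by (induction n) (auto simp: padic_abs_mult)

lemma padic_abs_minus [simp]: "\<bar>- x :: 'a\<bar>\<^sub>p = \<bar>x\<bar>\<^sub>p"
  using dist_eq_padic_abs[of x 0] dist_eq_padic_abs[of 0 x] by (simp add: dist_commute)

lemma padic_abs_diff: "\<bar>x - y :: 'a\<bar>\<^sub>p \<le> max \<bar>x\<bar>\<^sub>p \<bar>y\<bar>\<^sub>p"
  using padic_abs_add[of x "- y"] by simp

lemma padic_abs_triangle: "\<bar>x + y :: 'a\<bar>\<^sub>p \<le> \<bar>x\<bar>\<^sub>p + \<bar>y\<bar>\<^sub>p"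
  using padic_abs_add[of x y] padic_abs_nonneg[of x] padic_abs_nonneg[of y] by linarith

lemma padic_abs_inverse: "\<bar>inverse x :: 'a\<bar>\<^sub>p = inverse \<bar>x\<bar>\<^sub>p"
proof (cases "x = 0")
  case False
  then have "\<bar>x\<bar>\<^sub>p * \<bar>inverse x\<bar>\<^sub>p = 1"
    by (simp flip: padic_abs_mult)
  then show ?thesis
    by (metis inverse_unique)
qed simp

lemma padic_abs_divide: "\<bar>x / y :: 'a\<bar>\<^sub>p = \<bar>x\<bar>\<^sub>p / \<bar>y\<bar>\<^sub>p"
  by (simp add: divide_inverse padic_abs_mult padic_abs_inverse)

text \<open>The condition \<open>0 \<le> B\<close> covers empty and infinite index sets, over which
  the sum is 0.\<close>

lemma padic_abs_sum_le:
  assumes "\<And>i. i \<in> A \<Longrightarrow> \<bar>f i :: 'a\<bar>\<^sub>p \<le> B" and "0 \<le> B"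
  shows "\<bar>sum f A\<bar>\<^sub>p \<le> B"
  using assms(1)
proof (induction A rule: infinite_finite_induct)
  case (insert x A)
  then show ?case
    using padic_abs_add[of "f x" "sum f A"] by (fastforce intro: order_trans)
qed (use assms(2) in auto)

lemma padic_abs_of_nat_le: "\<bar>of_nat n :: 'a\<bar>\<^sub>p \<le> 1"
proof (induction n)
  case (Suc n)
  then show ?case
    using padic_abs_add[of 1 "of_nat n"] by simp
qed simp

lemma padic_abs_of_int_le: "\<bar>of_int n :: 'a\<bar>\<^sub>p \<le> 1"
  by (cases n) (use padic_abs_of_nat_le[of "Suc _"] padic_abs_of_nat_le in \<open>auto simp del: of_nat_Suc\<close>)

section \<open>Limits and infinite sums in the ultrametric topology\<close>

lemma tendsto_padic_iff: "((f :: nat \<Rightarrow> 'a) \<longlonglongrightarrow> l) \<longleftrightarrow> (\<lambda>n. \<bar>f n - l\<bar>\<^sub>p) \<longlonglongrightarrow> 0"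
  by (subst tendsto_dist_iff) (simp add: dist_eq_padic_abs)

lemma tendsto_padic_abs:
  assumes "(f :: nat \<Rightarrow> 'a) \<longlonglongrightarrow> l"
  shows "(\<lambda>n. \<bar>f n\<bar>\<^sub>p) \<longlonglongrightarrow> \<bar>l\<bar>\<^sub>p"
  unfolding padic_abs_def by (intro tendsto_dist assms tendsto_const)

lemma tendsto_padic_add:
  assumes "(f :: nat \<Rightarrow> 'a) \<longlonglongrightarrow> l" "g \<longlonglongrightarrow> m"
  shows "(\<lambda>n. f n + g n) \<longlonglongrightarrow> l + m"
proof -
  have "(\<lambda>n. \<bar>f n - l\<bar>\<^sub>p + \<bar>g n - m\<bar>\<^sub>p) \<longlonglongrightarrow> 0"
    using tendsto_add[of _ 0 _ _ 0] assms by (simp add: tendsto_padic_iff)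
  then show ?thesis
    unfolding tendsto_padic_iff
    by (rule real_tendsto_sandwich[OF _ _ tendsto_const, rotated 2])
       (auto intro!: always_eventually order_trans[OF _ padic_abs_triangle] simp: algebra_simps)
qed

lemma tendsto_padic_cmult:
  assumes "(f :: nat \<Rightarrow> 'a) \<longlonglongrightarrow> l"
  shows "(\<lambda>n. c * f n) \<longlonglongrightarrow> c * l"
proof -
  have "(\<lambda>n. \<bar>c\<bar>\<^sub>p * \<bar>f n - l\<bar>\<^sub>p) \<longlonglongrightarrow> 0"
    using tendsto_mult_right_zero assms by (simp add: tendsto_padic_iff)
  then show ?thesis
    by (simp add: tendsto_padic_iff flip: padic_abs_mult right_diff_distrib)
qed

lemma sums_padic_add:
  "(f :: nat \<Rightarrow> 'a) sums l \<Longrightarrow> g sums m \<Longrightarrow> (\<lambda>n. f n + g n) sums (l + m)"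
  unfolding sums_def by (simp add: sum.distrib tendsto_padic_add)

lemma sums_padic_cmult: "(f :: nat \<Rightarrow> 'a) sums l \<Longrightarrow> (\<lambda>n. c * f n) sums (c * l)"
  unfolding sums_def by (simp add: tendsto_padic_cmult flip: sum_distrib_left)

lemma sums_padic_sum:
  assumes "\<And>i. i \<in> A \<Longrightarrow> (f i :: nat \<Rightarrow> 'a) sums l i"
  shows "(\<lambda>n. \<Sum>i\<in>A. f i n) sums (\<Sum>i\<in>A. l i)"
  using assms by (induction A rule: infinite_finite_induct) (auto intro: sums_padic_add)

text \<open>Prepending zeros aligns indices: it places the rows of the Cauchy product and moves the
  logarithm series from index 0 to degree 1.\<close>

lemma sums_padic_shift:
  assumes "(f :: nat \<Rightarrow> 'a) sums l"
  shows "(\<lambda>n. if i \<le> n then f (n - i) else 0) sums l"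
proof -
  have eq: "(\<Sum>k<n + i. if i \<le> k then f (k - i) else 0) = (\<Sum>k<n. f k)" for n
    by (induction n) (auto intro!: sum.neutral)
  then show ?thesis
    using assms unfolding sums_def by - (rule LIMSEQ_offset[where k = i], simp only: eq)
qed

text \<open>A remainder is no larger than the largest omitted term, so bounds on terms pass to
  remainders without being added up.\<close>

lemma padic_abs_tail_le:
  assumes "(f :: nat \<Rightarrow> 'a) sums l" and "\<And>n. N \<le> n \<Longrightarrow> \<bar>f n\<bar>\<^sub>p \<le> e"
  shows "\<bar>l - (\<Sum>i<N. f i)\<bar>\<^sub>p \<le> e"
proof (rule LIMSEQ_le_const2)
  show "(\<lambda>n. \<bar>(\<Sum>i<n. f i) + - (\<Sum>i<N. f i)\<bar>\<^sub>p) \<longlonglongrightarrow> \<bar>l - (\<Sum>i<N. f i)\<bar>\<^sub>p"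
    using tendsto_padic_abs[OF tendsto_padic_add[OF _ tendsto_const]] assms(1)[unfolded sums_def]
    by (metis (no_types) diff_conv_add_uminus)
  have "0 \<le> e"
    using assms(2)[of N] padic_abs_nonneg order_trans by blast
  have "\<bar>(\<Sum>i<n. f i) + - (\<Sum>i<N. f i)\<bar>\<^sub>p \<le> e" if "N \<le> n" for n
  proof -
    have "(\<Sum>i<n. f i) + - (\<Sum>i<N. f i) = (\<Sum>i\<in>{..<n} - {..<N}. f i)"
      using that by (subst sum_diff) auto
    then show ?thesis
      using assms(2) \<open>0 \<le> e\<close> by (auto intro!: padic_abs_sum_le)
  qed
  then show "\<exists>M. \<forall>n\<ge>M. \<bar>(\<Sum>i<n. f i) + - (\<Sum>i<N. f i)\<bar>\<^sub>p \<le> e"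
    by blast
qed

lemma padic_abs_sums_le: "(f :: nat \<Rightarrow> 'a) sums l \<Longrightarrow> (\<And>n. \<bar>f n\<bar>\<^sub>p \<le> e) \<Longrightarrow> \<bar>l\<bar>\<^sub>p \<le> e"
  using padic_abs_tail_le[of f l 0 e] by simp

text \<open>Two partial sums differ by at most the largest term between them, so null terms already
  make the partial sums Cauchy.\<close>

lemma summable_padic:
  assumes "(\<lambda>n. \<bar>f n :: 'a\<bar>\<^sub>p) \<longlonglongrightarrow> 0"
  shows "summable f"
proof -
  have "Cauchy (\<lambda>n. \<Sum>i<n. f i)"
  proof (rule metric_CauchyI)
    fix e :: real assume "0 < e"
    then obtain N where N: "\<And>n. n \<ge> N \<Longrightarrow> \<bar>f n\<bar>\<^sub>p < e / 2"
      using LIMSEQ_D[OF assms, of "e / 2"] by auto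
    have "\<bar>(\<Sum>i<n. f i) - (\<Sum>i<N. f i)\<bar>\<^sub>p \<le> e / 2" if "N \<le> n" for n
    proof -
      have "(\<Sum>i<n. f i) - (\<Sum>i<N. f i) = (\<Sum>i\<in>{..<n} - {..<N}. f i)"
        using that by (subst sum_diff) auto
      then show ?thesis
        using padic_abs_sum_le[of "{..<n} - {..<N}" f "e / 2"] less_imp_le[OF N] \<open>0 < e\<close> by auto
    qed
    then have "dist (\<Sum>i<m. f i) (\<Sum>i<n. f i) < e" if "N \<le> m" "N \<le> n" for m n
      unfolding dist_eq_padic_abs
      using padic_abs_diff[of "(\<Sum>i<m. f i) - (\<Sum>i<N. f i)" "(\<Sum>i<n. f i) - (\<Sum>i<N. f i)"] that \<open>0 < e\<close>
      by (smt (verit, best) diff_diff_eq2 diff_add_cancel field_sum_of_halves max_def)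
    then show "\<exists>M. \<forall>m\<ge>M. \<forall>n\<ge>M. dist (\<Sum>i<m. f i) (\<Sum>i<n. f i) < e"
      by blast
  qed
  then show ?thesis
    by (simp add: summable_iff_convergent Cauchy_convergent_iff)
qed

lemma summable_padic_tendsto_0:
  assumes "summable (f :: nat \<Rightarrow> 'a)"
  shows "(\<lambda>n. \<bar>f n\<bar>\<^sub>p) \<longlonglongrightarrow> 0"
proof -
  obtain l where l: "(\<lambda>n. \<Sum>i<n. f i) \<longlonglongrightarrow> l"
    using assms by (auto simp: summable_def sums_def)
  then have "(\<lambda>n. (\<Sum>i<Suc n. f i) + (- 1) * (\<Sum>i<n. f i)) \<longlonglongrightarrow> l + (- 1) * l"
    by (intro tendsto_padic_add tendsto_padic_cmult LIMSEQ_Suc)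
  then show ?thesis
    by (simp add: tendsto_padic_iff)
qed

section \<open>Interchange of two summations\<close>

lemma padic_abs_double_sums_block:
  fixes a :: "nat \<Rightarrow> nat \<Rightarrow> 'a"
  assumes a: "\<And>i j. N \<le> i \<or> N \<le> j \<Longrightarrow> \<bar>a i j\<bar>\<^sub>p \<le> e"
    and S: "\<And>i. a i sums S i" and L: "S sums L"
  shows "\<bar>L - (\<Sum>i<N. \<Sum>j<N. a i j)\<bar>\<^sub>p \<le> e"
proof -
  have e: "0 \<le> e"
    using a[of N 0] padic_abs_nonneg order_trans by blast
  have "\<bar>L - (\<Sum>i<N. S i)\<bar>\<^sub>p \<le> e"
    using a by (intro padic_abs_tail_le L padic_abs_sums_le[OF S]) auto
  moreover have "\<bar>\<Sum>i<N. S i - (\<Sum>j<N. a i j)\<bar>\<^sub>p \<le> e"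
    using a e by (intro padic_abs_sum_le padic_abs_tail_le[OF S]) auto
  moreover have "L - (\<Sum>i<N. \<Sum>j<N. a i j) = (L - (\<Sum>i<N. S i)) + (\<Sum>i<N. S i - (\<Sum>j<N. a i j))"
    by (simp add: sum_subtractf)
  ultimately show ?thesis
    using padic_abs_add[of "L - (\<Sum>i<N. S i)" "\<Sum>i<N. S i - (\<Sum>j<N. a i j)"]
    by (simp only: max.bounded_iff)
qed

text \<open>For every positive \<open>e\<close> all entries outside some square block are at most
  \<open>e\<close>. Both iterated sums then differ from the sum over that block by at most
  \<open>e\<close>, so they agree.\<close>

lemma sums_padic_swap:
  fixes a :: "nat \<Rightarrow> nat \<Rightarrow> 'a"
  assumes a: "\<And>e. 0 < e \<Longrightarrow> \<exists>N. \<forall>i j. N \<le> i \<or> N \<le> j \<longrightarrow> \<bar>a i j\<bar>\<^sub>p < e"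
    and S: "\<And>i. a i sums S i" and T: "\<And>j. (\<lambda>i. a i j) sums T j"
  obtains L where "S sums L" "T sums L"
proof -
  have le: "\<exists>N. \<forall>i j. N \<le> i \<or> N \<le> j \<longrightarrow> \<bar>a i j\<bar>\<^sub>p \<le> e" if "0 < e" for e
    using a[OF that] less_imp_le by meson
  have "(\<lambda>n. \<bar>S n\<bar>\<^sub>p) \<longlonglongrightarrow> 0"
  proof (rule LIMSEQ_I)
    fix e :: real assume "0 < e"
    then obtain N where N: "\<And>i j. N \<le> i \<or> N \<le> j \<Longrightarrow> \<bar>a i j\<bar>\<^sub>p \<le> e / 2"
      using le[of "e / 2"] by auto
    then have "\<bar>S i\<bar>\<^sub>p \<le> e / 2" if "N \<le> i" for i
      using that by (intro padic_abs_sums_le[OF S]) auto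
    then show "\<exists>N. \<forall>n\<ge>N. norm (\<bar>S n\<bar>\<^sub>p - 0) < e"
      using \<open>0 < e\<close> by (force intro!: exI[of _ N])
  qed
  then obtain L where L: "S sums L"
    using summable_padic by (auto simp: summable_def)
  have "(\<lambda>n. \<bar>T n\<bar>\<^sub>p) \<longlonglongrightarrow> 0"
  proof (rule LIMSEQ_I)
    fix e :: real assume "0 < e"
    then obtain N where N: "\<And>i j. N \<le> i \<or> N \<le> j \<Longrightarrow> \<bar>a i j\<bar>\<^sub>p \<le> e / 2"
      using le[of "e / 2"] by auto
    then have "\<bar>T i\<bar>\<^sub>p \<le> e / 2" if "N \<le> i" for i
      using that by (intro padic_abs_sums_le[OF T]) auto
    then show "\<exists>N. \<forall>n\<ge>N. norm (\<bar>T n\<bar>\<^sub>p - 0) < e"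
      using \<open>0 < e\<close> by (force intro!: exI[of _ N])
  qed
  then obtain M where M: "T sums M"
    using summable_padic by (auto simp: summable_def)
  have "\<bar>L - M\<bar>\<^sub>p \<le> e" if "0 < e" for e
  proof -
    obtain N where N: "\<And>i j. N \<le> i \<or> N \<le> j \<Longrightarrow> \<bar>a i j\<bar>\<^sub>p \<le> e"
      using le \<open>0 < e\<close> by blast
    let ?B = "\<Sum>i<N. \<Sum>j<N. a i j"
    have "\<bar>L - ?B\<bar>\<^sub>p \<le> e"
      by (rule padic_abs_double_sums_block[OF N S L])
    moreover have "\<bar>M - ?B\<bar>\<^sub>p \<le> e"
      using padic_abs_double_sums_block[OF _ T M, of N e] N by (subst sum.swap) auto
    ultimately show ?thesis
      using padic_abs_diff[of "L - ?B" "M - ?B"] by simp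
  qed
  then have "\<bar>L - M\<bar>\<^sub>p \<le> 0"
    using field_le_epsilon[of "\<bar>L - M\<bar>\<^sub>p" 0] by simp
  then have "L = M"
    using padic_abs_nonneg[of "L - M"] by (auto simp: order_antisym_conv)
  then show ?thesis
    using that L M by blast
qed

text \<open>The uniform bound \<open>r i\<close> disposes of all but finitely many rows, and each
  remaining row is null on its own.\<close>

lemma double_null_criterion:
  fixes a :: "nat \<Rightarrow> nat \<Rightarrow> 'a"
  assumes r: "r \<longlonglongrightarrow> 0" and le: "\<And>i j. \<bar>a i j\<bar>\<^sub>p \<le> r i"
    and row: "\<And>i. (\<lambda>j. \<bar>a i j\<bar>\<^sub>p) \<longlonglongrightarrow> 0" and "0 < e"
  shows "\<exists>N. \<forall>i j. N \<le> i \<or> N \<le> j \<longrightarrow> \<bar>a i j\<bar>\<^sub>p < e"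
proof -
  obtain N where N: "\<And>i. N \<le> i \<Longrightarrow> r i < e"
    using LIMSEQ_D[OF r \<open>0 < e\<close>] by (auto dest: abs_less_iff[THEN iffD1])
  have "\<forall>i. \<exists>M. \<forall>j\<ge>M. \<bar>a i j\<bar>\<^sub>p < e"
    using LIMSEQ_D[OF row \<open>0 < e\<close>] by auto
  then obtain M where M: "\<And>i j. M i \<le> j \<Longrightarrow> \<bar>a i j\<bar>\<^sub>p < e"
    by metis
  \<comment> \<open>The sum of the thresholds \<open>M i\<close> with \<open>i < N\<close> dominates
    each of them, and it makes sense for \<open>N = 0\<close> as well.\<close>
  have "\<bar>a i j\<bar>\<^sub>p < e" if "N + (\<Sum>i<N. M i) \<le> i \<or> N + (\<Sum>i<N. M i) \<le> j" for i j
  proof (cases "N \<le> i")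
    case True
    then show ?thesis
      using N le order_le_less_trans by blast
  next
    case False
    then have "M i \<le> (\<Sum>i<N. M i)"
      by (intro member_le_sum) auto
    then show ?thesis
      using False that M[of i j] by auto
  qed
  then show ?thesis
    by blast
qed

text \<open>Row \<open>i\<close> of the array is \<open>b\<close>, shifted by \<open>i\<close> and
  scaled by \<open>a i\<close>. The rows sum to \<open>a i * B\<close>, while the columns are the
  finite convolution sums.\<close>

lemma sums_padic_Cauchy_product:
  fixes a b :: "nat \<Rightarrow> 'a"
  assumes a: "a sums A" and b: "b sums B"
  shows "(\<lambda>k. \<Sum>i=0..k. a i * b (k - i)) sums (A * B)"
proof -
  let ?c = "\<lambda>i k. a i * (if i \<le> k then b (k - i) else 0)"
  have a0: "(\<lambda>n. \<bar>a n\<bar>\<^sub>p) \<longlonglongrightarrow> 0" and b0: "(\<lambda>n. \<bar>b n\<bar>\<^sub>p) \<longlonglongrightarrow> 0"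
    using a b summable_padic_tendsto_0 by (auto simp: summable_def)
  have "Bseq (\<lambda>n. \<bar>b n\<bar>\<^sub>p)"
    using b0 convergentI convergent_imp_Bseq by blast
  then obtain K where K: "\<And>n. \<bar>b n\<bar>\<^sub>p \<le> K" "0 < K"
    by (auto simp: Bseq_def)
  have row: "?c i sums (a i * B)" for i
    by (intro sums_padic_cmult sums_padic_shift b)
  have "(\<lambda>i. \<bar>a i\<bar>\<^sub>p * K) \<longlonglongrightarrow> 0"
    using tendsto_mult_left_zero[OF a0] .
  then have null: "\<exists>N. \<forall>i j. N \<le> i \<or> N \<le> j \<longrightarrow> \<bar>?c i j\<bar>\<^sub>p < e" if "0 < e" for e
  proof (rule double_null_criterion[OF _ _ _ that])
    show "\<bar>?c i j\<bar>\<^sub>p \<le> \<bar>a i\<bar>\<^sub>p * K" for i j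
      using K by (auto simp: padic_abs_mult intro!: mult_left_mono)
    show "(\<lambda>j. \<bar>?c i j\<bar>\<^sub>p) \<longlonglongrightarrow> 0" for i
      using row summable_padic_tendsto_0 by (auto simp: summable_def)
  qed
  have col: "(\<lambda>i. ?c i k) sums (\<Sum>i=0..k. a i * b (k - i))" for k
    using sums_finite[of "{0..k}" "\<lambda>i. ?c i k"] by simp
  obtain L where L: "(\<lambda>i. a i * B) sums L" "(\<lambda>k. \<Sum>i=0..k. a i * b (k - i)) sums L"
    by (rule sums_padic_swap[OF null row col])
  moreover have "(\<lambda>i. a i * B) sums (A * B)"
    using sums_padic_cmult[OF a, of B] by (simp add: mult.commute)
  ultimately show ?thesis
    using sums_unique2 by blast
qed

section \<open>Evaluation of formal power series\<close>

lemma fps_sums_padic_mult: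
  fixes f g :: "'a fps"
  assumes "(\<lambda>j. f $ j * y ^ j) sums u" "(\<lambda>j. g $ j * y ^ j) sums v"
  shows "(\<lambda>j. (f * g) $ j * y ^ j) sums (u * v)"
  unfolding fps_mult_nth_power by (rule sums_padic_Cauchy_product[OF assms])

lemma fps_sums_padic_power:
  fixes f :: "'a fps"
  assumes "(\<lambda>j. f $ j * y ^ j) sums u"
  shows "(\<lambda>j. (f ^ n) $ j * y ^ j) sums (u ^ n)"
proof (induction n)
  case 0
  then show ?case
    using sums_finite[of "{0}" "\<lambda>j. (1 :: 'a fps) $ j * y ^ j"] by simp
next
  case (Suc n)
  then show ?case
    using fps_sums_padic_mult[OF assms] by simp
qed

lemma padic_abs_fps_mult_le:
  fixes f g :: "'a fps"
  assumes "\<And>j. \<bar>f $ j * y ^ j\<bar>\<^sub>p \<le> B" "\<And>j. \<bar>g $ j * y ^ j\<bar>\<^sub>p \<le> C"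
  shows "\<bar>(f * g) $ j * y ^ j\<bar>\<^sub>p \<le> B * C"
proof -
  have "0 \<le> B" "0 \<le> C"
    using assms padic_abs_nonneg order_trans by blast+
  have "(f * g) $ j * y ^ j = (\<Sum>i=0..j. (f $ i * y ^ i) * (g $ (j - i) * y ^ (j - i)))"
    by (rule fps_mult_nth_power)
  also have "\<bar>\<dots>\<bar>\<^sub>p \<le> B * C"
    using assms \<open>0 \<le> B\<close> \<open>0 \<le> C\<close>
    by (auto intro!: padic_abs_sum_le mult_mono simp: padic_abs_mult[of "f $ _ * _"])
  finally show ?thesis .
qed

lemma padic_abs_fps_power_le:
  fixes f :: "'a fps"
  assumes "\<And>j. \<bar>f $ j * y ^ j\<bar>\<^sub>p \<le> \<rho>"
  shows "\<bar>(f ^ n) $ j * y ^ j\<bar>\<^sub>p \<le> \<rho> ^ n"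
proof (induction n arbitrary: j)
  case 0
  then show ?case by (cases j) auto
next
  case (Suc n)
  then show ?case
    using padic_abs_fps_mult_le[OF assms Suc] by simp
qed

text \<open>Substitution needs control of the single terms of \<open>g\<close>, not just of its
  value \<open>v\<close>: their bound \<open>\<rho>\<close> gives the bound
  \<open>\<rho> ^ n\<close> for the terms of \<open>g ^ n\<close>, hence a uniform row bound for the
  array whose rows are the series of \<open>F $ n * v ^ n\<close>.\<close>

lemma fps_sums_padic_compose:
  fixes F g :: "'a fps"
  assumes g0: "g $ 0 = 0" and g: "(\<lambda>j. g $ j * y ^ j) sums v"
    and le: "\<And>j. \<bar>g $ j * y ^ j\<bar>\<^sub>p \<le> \<rho>"
    and F: "(\<lambda>n. \<bar>F $ n\<bar>\<^sub>p * \<rho> ^ n) \<longlonglongrightarrow> 0"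
  obtains w where "(\<lambda>n. F $ n * v ^ n) sums w" "(\<lambda>j. (F oo g) $ j * y ^ j) sums w"
proof -
  let ?a = "\<lambda>n j. F $ n * ((g ^ n) $ j * y ^ j)"
  have row: "?a n sums (F $ n * v ^ n)" for n
    by (intro sums_padic_cmult fps_sums_padic_power g)
  have null: "\<exists>N. \<forall>i j. N \<le> i \<or> N \<le> j \<longrightarrow> \<bar>?a i j\<bar>\<^sub>p < e" if "0 < e" for e
  proof (rule double_null_criterion[OF F _ _ that])
    show "\<bar>?a i j\<bar>\<^sub>p \<le> \<bar>F $ i\<bar>\<^sub>p * \<rho> ^ i" for i j
      unfolding padic_abs_mult[of "F $ i"]
      by (intro mult_left_mono padic_abs_fps_power_le le) auto
    show "(\<lambda>j. \<bar>?a i j\<bar>\<^sub>p) \<longlonglongrightarrow> 0" for i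
      using row summable_padic_tendsto_0 by (auto simp: summable_def)
  qed
  \<comment> \<open>Since \<open>g\<close> has no constant term, \<open>g ^ n\<close> starts at
    degree \<open>n\<close>, so column \<open>j\<close> ends at row \<open>j\<close>.\<close>
  have col: "(\<lambda>n. ?a n j) sums ((F oo g) $ j * y ^ j)" for j
    using sums_finite[of "{0..j}" "\<lambda>n. ?a n j"] startsby_zero_power_prefix[OF g0]
    by (simp add: fps_compose_nth sum_distrib_right mult.assoc)
  show ?thesis
    by (rule sums_padic_swap[OF null row col that])
qed

end

section \<open>Exponential, logarithm, Teichmueller representatives and Euler numbers\<close>

text \<open>This is the binomial convolution of exponential generating functions. Its integer
  weights are what preserves p-integrality.\<close>

lemma fps_mult_nth_fact:
  "fact m * (f * g :: rat fps) $ m =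
     (\<Sum>i=0..m. of_nat (m choose i) * (fact i * f $ i) * (fact (m - i) * g $ (m - i)))"
  unfolding fps_mult_nth sum_distrib_left
proof (rule sum.cong)
  fix i assume "i \<in> {0..m}"
  then have "fact m = (of_nat (m choose i) * fact i * fact (m - i) :: rat)"
    using binomial_fact[of i m, where ?'a = rat] by simp
  then show "fact m * (f $ i * g $ (m - i)) =
      of_nat (m choose i) * (fact i * f $ i) * (fact (m - i) * g $ (m - i))"
    by simp
qed simp

lemma real_null_squeeze:
  fixes f g :: "nat \<Rightarrow> real"
  assumes "\<And>n. 0 \<le> f n" "\<And>n. f n \<le> g n" "g \<longlonglongrightarrow> 0"
  shows "f \<longlonglongrightarrow> 0"
  by (rule real_tendsto_sandwich[OF _ _ tendsto_const assms(3)]) (use assms in auto)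

locale padic_field = ultrametric_field type
  for type :: "'a::{field_char_0,complete_space} itself" +
  fixes p :: nat
  assumes prime_p: "prime p" and odd_p: "odd p"
    and padic_abs_p: "\<bar>of_nat p :: 'a\<bar>\<^sub>p = 1 / real p"
begin

section \<open>The p-adic absolute value of integers\<close>

lemma p_ge_3: "3 \<le> p"
  using prime_ge_2_nat[OF prime_p] odd_p by (cases "p = 2") auto

lemma inverse_p_less_1: "1 / real p < 1"
  using p_ge_3 by simp

text \<open>In a Bezout relation \<open>u * int p + v * n = 1\<close> the first summand has absolute
  value below 1, so the strong triangle inequality forces \<open>v * n\<close>, and hence
  \<open>n\<close>, to have absolute value at least 1.\<close>

lemma padic_abs_of_int_eq_1:
  assumes "\<not> int p dvd n"
  shows "\<bar>of_int n :: 'a\<bar>\<^sub>p = 1"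
proof (rule antisym)
  show "\<bar>of_int n :: 'a\<bar>\<^sub>p \<le> 1"
    by (rule padic_abs_of_int_le)
  have "coprime (int p) n"
    using assms prime_p by (intro prime_imp_coprime) auto
  then obtain u v where "u * int p + v * n = 1"
    using coprime_bezout_strong bezout_int[of "int p" n] by (auto simp: coprime_iff_gcd_eq_1)
  then have "of_int u * of_nat p + of_int v * of_int n = (1 :: 'a)"
    by (metis of_int_1 of_int_add of_int_mult of_int_of_nat_eq)
  then have "1 \<le> max \<bar>of_int u * of_nat p :: 'a\<bar>\<^sub>p \<bar>of_int v * of_int n :: 'a\<bar>\<^sub>p"
    using padic_abs_add[of "of_int u * of_nat p" "of_int v * of_int n"] by simp
  moreover have "\<bar>of_int u * of_nat p :: 'a\<bar>\<^sub>p < 1"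
    using mult_right_mono[OF padic_abs_of_int_le[of u], of "1 / real p"] inverse_p_less_1
    by (simp add: padic_abs_mult padic_abs_p)
  moreover have "\<bar>of_int v * of_int n :: 'a\<bar>\<^sub>p \<le> \<bar>of_int n :: 'a\<bar>\<^sub>p"
    using mult_right_mono[OF padic_abs_of_int_le[of v], of "\<bar>of_int n :: 'a\<bar>\<^sub>p"]
    by (simp add: padic_abs_mult)
  ultimately show "1 \<le> \<bar>of_int n :: 'a\<bar>\<^sub>p"
    by linarith
qed

lemma padic_abs_of_nat_eq_1: "\<not> p dvd n \<Longrightarrow> \<bar>of_nat n :: 'a\<bar>\<^sub>p = 1"
  using padic_abs_of_int_eq_1[of "int n"] by simp

lemma padic_abs_of_int_dvd_le:
  assumes "int p ^ k dvd n"
  shows "\<bar>of_int n :: 'a\<bar>\<^sub>p \<le> (1 / real p) ^ k"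
proof -
  obtain m where "n = int p ^ k * m"
    using assms by (elim dvdE)
  then have "\<bar>of_int n :: 'a\<bar>\<^sub>p = (1 / real p) ^ k * \<bar>of_int m :: 'a\<bar>\<^sub>p"
    by (simp add: padic_abs_mult padic_abs_power padic_abs_p)
  then show ?thesis
    using mult_left_mono[OF padic_abs_of_int_le[of m], of "(1 / real p) ^ k"] by simp
qed

text \<open>The power of \<open>p\<close> contained in \<open>n\<close> is at most \<open>n\<close>.
  This crude bound is enough for the denominators of the logarithm.\<close>

lemma padic_abs_of_nat_ge:
  assumes "n > 0"
  shows "1 / real n \<le> \<bar>of_nat n :: 'a\<bar>\<^sub>p"
proof -
  have "\<not> is_unit p"
    using prime_p not_prime_unit by blast
  then obtain m where m: "n = p ^ multiplicity p n * m" "\<not> p dvd m"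
    using multiplicity_decompose'[of n p] assms by auto
  have "p ^ multiplicity p n \<le> n"
    using assms by (intro dvd_imp_le multiplicity_dvd)
  moreover have "0 < p ^ multiplicity p n"
    using p_ge_3 by simp
  ultimately have "1 / real n \<le> 1 / real (p ^ multiplicity p n)"
    by (intro divide_left_mono mult_pos_pos) (use assms in \<open>auto simp del: of_nat_power\<close>)
  also have "\<dots> = \<bar>of_nat (p ^ multiplicity p n * m) :: 'a\<bar>\<^sub>p"
    using m(2) by (simp add: padic_abs_mult padic_abs_power padic_abs_p padic_abs_of_nat_eq_1 power_divide)
  finally show ?thesis
    using m(1) by simp
qed

section \<open>Factorials and the radius of the disc\<close>

definition root_p :: real where
  "root_p = real p powr (1 / (real p - 1))"

text \<open>By Legendre's formula \<open>root_p ^ m\<close> bounds \<open>1 / fact m\<close>, while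
  the \<open>m\<close>-th power of an element of size at most \<open>1 / p\<close> contributes
  \<open>(1 / real p) ^ m\<close>. So \<open>rate\<close> is the geometric rate for the exponential
  and for the inner series; its reciprocal is \<open>radius_D p\<close>.\<close>

definition rate :: real where
  "rate = root_p / real p"

lemma root_p_ge_1: "1 \<le> root_p"
  using p_ge_3 by (simp add: root_p_def ge_one_powr_ge_zero)

lemma root_p_power: "root_p ^ (p - 1) = real p"
proof -
  have "root_p ^ (p - 1) = root_p powr (real p - 1)"
    using root_p_ge_1 p_ge_3 by (simp add: of_nat_diff flip: powr_realpow)
  then show ?thesis
    using p_ge_3 by (simp add: root_p_def powr_powr)
qed

lemma root_p_less: "root_p < real p"
proof -
  have "real p powr (1 / (real p - 1)) < real p powr 1"
    using p_ge_3 by (intro powr_less_mono) (auto simp: field_simps)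
  then show ?thesis
    using p_ge_3 by (simp add: root_p_def)
qed

lemma rate_pos: "0 < rate"
  using root_p_ge_1 p_ge_3 by (simp add: rate_def)

lemma rate_less_1: "rate < 1"
  using root_p_less p_ge_3 by (simp add: rate_def)

lemma radius_D_rate: "radius_D p * rate = 1"
  using p_ge_3 by (simp add: radius_D_def rate_def root_p_def powr_diff)

lemma radius_D_gt_1: "1 < radius_D p"
proof -
  have "radius_D p = 1 / rate"
    using radius_D_rate rate_pos by (simp add: field_simps)
  then show ?thesis
    using rate_pos rate_less_1 by simp
qed

text \<open>Among \<open>p\<close> consecutive factors only the multiple of \<open>p\<close> has
  absolute value below 1. The multiples of \<open>p\<close> up to \<open>p * q\<close> contribute
  \<open>q\<close> factors \<open>p\<close> and a copy of \<open>fact q\<close>, which is Legendre's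
  formula in recursive form.\<close>

lemma padic_abs_fact_mult_p:
  "\<bar>fact (p * q) :: 'a\<bar>\<^sub>p = (1 / real p) ^ q * \<bar>fact q :: 'a\<bar>\<^sub>p"
  and padic_abs_fact_add:
  "j < p \<Longrightarrow> \<bar>fact (p * q + j) :: 'a\<bar>\<^sub>p = \<bar>fact (p * q) :: 'a\<bar>\<^sub>p"
proof -
  have add: "\<bar>fact (p * q + j) :: 'a\<bar>\<^sub>p = \<bar>fact (p * q) :: 'a\<bar>\<^sub>p" if "j < p" for j q
    using that
  proof (induction j)
    case (Suc j)
    have "\<not> p dvd Suc (p * q + j)"
      using Suc.prems by (metis Suc_neq_Zero add_Suc_right dvd_add_right_iff dvd_triv_left nat_dvd_not_less zero_less_Suc)
    then have "\<bar>of_nat (Suc (p * q + j)) :: 'a\<bar>\<^sub>p = 1"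
      by (rule padic_abs_of_nat_eq_1)
    then show ?case
      using Suc by (simp add: padic_abs_mult del: of_nat_Suc)
  qed simp
  show "\<bar>fact (p * q) :: 'a\<bar>\<^sub>p = (1 / real p) ^ q * \<bar>fact q :: 'a\<bar>\<^sub>p"
  proof (induction q)
    case (Suc q)
    have eq: "p * Suc q = Suc (p * q + (p - 1))"
      using p_ge_3 by simp
    have "(fact (p * Suc q) :: 'a) = of_nat p * of_nat (Suc q) * fact (p * q + (p - 1))"
      unfolding eq fact_Suc unfolding eq[symmetric] of_nat_mult ..
    then have "\<bar>fact (p * Suc q) :: 'a\<bar>\<^sub>p = 1 / real p * \<bar>of_nat (Suc q) :: 'a\<bar>\<^sub>p * \<bar>fact (p * q) :: 'a\<bar>\<^sub>p"
      using p_ge_3 add[of "p - 1" q] by (simp only: padic_abs_mult padic_abs_p)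
    then show ?case
      by (simp add: Suc padic_abs_mult del: of_nat_Suc)
  qed simp
  show "j < p \<Longrightarrow> \<bar>fact (p * q + j) :: 'a\<bar>\<^sub>p = \<bar>fact (p * q) :: 'a\<bar>\<^sub>p"
    by (rule add)
qed

text \<open>Induction along \<open>m div p\<close> replaces the digit sum of Legendre's
  formula.\<close>

lemma padic_abs_fact_ge: "1 \<le> \<bar>fact m :: 'a\<bar>\<^sub>p * root_p ^ m"
proof (induction m rule: less_induct)
  case (less m)
  show ?case
  proof (cases "m = 0")
    case False
    define q j where "q = m div p" and "j = m mod p"
    have m: "m = p * q + j" and "j < p"
      using p_ge_3 by (auto simp: q_def j_def)
    have "q < m"
      using False p_ge_3 by (simp add: q_def)
    \<comment> \<open>The first factor is \<open>real p ^ q\<close> and cancels the powers of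
      \<open>1 / real p\<close> in the factorial, the second belongs to the induction hypothesis for
      \<open>q\<close>, and the third is at least 1.\<close>
    have "root_p ^ m = (root_p ^ (p - 1)) ^ q * root_p ^ q * root_p ^ j"
    proof -
      have "m = (p - 1) * q + q + j"
        using p_ge_3 by (subst m) (cases p; simp)
      then show ?thesis
        by (simp add: power_add power_mult)
    qed
    then have "\<bar>fact m :: 'a\<bar>\<^sub>p * root_p ^ m = \<bar>fact q :: 'a\<bar>\<^sub>p * root_p ^ q * root_p ^ j"
      unfolding root_p_power using \<open>j < p\<close> p_ge_3
      by (subst m) (simp add: padic_abs_fact_add padic_abs_fact_mult_p power_divide)
    then show ?thesis
      using mult_mono[OF less[OF \<open>q < m\<close>] one_le_power[OF root_p_ge_1, of j]] root_p_ge_1 by simp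
  qed simp
qed

lemma padic_abs_inverse_fact_le: "\<bar>1 / fact m :: 'a\<bar>\<^sub>p \<le> root_p ^ m"
proof -
  have "0 < \<bar>fact m :: 'a\<bar>\<^sub>p"
    using padic_abs_nonneg[of "fact m"] padic_abs_eq_0_iff[of "fact m"] by (simp add: less_le)
  then show ?thesis
    using padic_abs_fact_ge[of m] by (simp add: padic_abs_divide divide_le_eq mult.commute)
qed

section \<open>Exponential and logarithm\<close>

lemma exp_p_sums:
  assumes L: "\<bar>L :: 'a\<bar>\<^sub>p \<le> 1 / real p" and s: "\<bar>s\<bar>\<^sub>p < radius_D p"
  shows "(\<lambda>k. (L ^ k / fact k) * s ^ k) sums exp_p (s * L)"
proof -
  \<comment> \<open>This ratio of the dominating geometric series is below 1 exactly on the disc,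
    which explains its radius.\<close>
  have s1: "\<bar>s\<bar>\<^sub>p * rate < 1"
    using mult_strict_right_mono[OF s rate_pos] by (simp add: radius_D_rate)
  have "\<bar>(L ^ k / fact k) * s ^ k\<bar>\<^sub>p \<le> (\<bar>s\<bar>\<^sub>p * rate) ^ k" for k
  proof -
    have "\<bar>(L ^ k / fact k) * s ^ k\<bar>\<^sub>p = \<bar>L\<bar>\<^sub>p ^ k * \<bar>1 / fact k :: 'a\<bar>\<^sub>p * \<bar>s\<bar>\<^sub>p ^ k"
      by (simp add: padic_abs_mult padic_abs_divide padic_abs_power)
    also have "\<dots> \<le> (1 / real p) ^ k * root_p ^ k * \<bar>s\<bar>\<^sub>p ^ k"
      using L padic_abs_inverse_fact_le root_p_ge_1 by (intro mult_mono power_mono mult_nonneg_nonneg) auto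
    also have "\<dots> = (\<bar>s\<bar>\<^sub>p * rate) ^ k"
      by (simp add: rate_def power_mult_distrib power_divide)
    finally show ?thesis .
  qed
  moreover have "(\<lambda>k. (\<bar>s\<bar>\<^sub>p * rate) ^ k) \<longlonglongrightarrow> 0"
    using s1 rate_pos by (intro LIMSEQ_power_zero) (simp add: abs_mult)
  ultimately have "(\<lambda>k. \<bar>(L ^ k / fact k) * s ^ k\<bar>\<^sub>p) \<longlonglongrightarrow> 0"
    by - (rule real_null_squeeze, auto)
  then have "summable (\<lambda>k. (L ^ k / fact k) * s ^ k)"
    by (rule summable_padic)
  then show ?thesis
    using summable_sums by (fastforce simp: exp_p_def power_mult_distrib mult.commute)
qed

text \<open>The first bound tends to 0 and gives convergence. The second is uniform, since
  \<open>j \<le> p ^ (j - 1)\<close> leaves one factor \<open>1 / p\<close>; it serves as the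
  \<open>\<rho>\<close> for substitution and bounds the logarithm itself.\<close>

lemma padic_abs_ln_term_le:
  assumes "\<bar>y :: 'a\<bar>\<^sub>p \<le> 1 / real p" "0 < j"
  shows "\<bar>y ^ j / of_nat j\<bar>\<^sub>p \<le> real j * (1 / real p) ^ j"
    and "\<bar>y ^ j / of_nat j\<bar>\<^sub>p \<le> 1 / real p"
proof -
  have "1 / \<bar>of_nat j :: 'a\<bar>\<^sub>p \<le> real j"
    using le_imp_inverse_le[OF padic_abs_of_nat_ge[OF assms(2)]] assms(2) by (simp add: inverse_eq_divide)
  then have "\<bar>y\<bar>\<^sub>p ^ j * (1 / \<bar>of_nat j :: 'a\<bar>\<^sub>p) \<le> (1 / real p) ^ j * real j"
    using assms by (intro mult_mono power_mono) auto
  then show le: "\<bar>y ^ j / of_nat j\<bar>\<^sub>p \<le> real j * (1 / real p) ^ j"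
    by (simp add: padic_abs_divide padic_abs_power mult.commute)
  have "j \<le> p ^ (j - 1)"
  proof -
    have "Suc n \<le> p ^ n" for n
      using p_ge_3 less_exp[of n] power_mono[of 2 p n] by linarith
    from this[of "j - 1"] show ?thesis
      using assms(2) by simp
  qed
  then have "real j \<le> real p ^ (j - 1)"
    by (metis of_nat_le_iff of_nat_power)
  then have "real j * (1 / real p) ^ j \<le> real p ^ (j - 1) * (1 / real p) ^ j"
    by (intro mult_right_mono) auto
  also have "\<dots> = 1 / real p"
    using assms(2) p_ge_3 by (cases j) (auto simp: power_divide)
  finally show "\<bar>y ^ j / of_nat j\<bar>\<^sub>p \<le> 1 / real p"
    using le by simp
qed

lemma log_p_sums:
  assumes "\<bar>y :: 'a\<bar>\<^sub>p \<le> 1 / real p"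
  shows "(\<lambda>j. fps_ln 1 $ j * y ^ j) sums log_p (1 + y)"
    and "\<bar>fps_ln 1 $ j * y ^ j\<bar>\<^sub>p \<le> 1 / real p"
    and "\<bar>log_p (1 + y)\<bar>\<^sub>p \<le> 1 / real p"
proof -
  have abs_eq: "\<bar>fps_ln 1 $ j * y ^ j\<bar>\<^sub>p = \<bar>y ^ j / of_nat j\<bar>\<^sub>p" if "0 < j" for j
    using that by (simp add: fps_ln_nth padic_abs_mult padic_abs_divide padic_abs_power)
  show le: "\<bar>fps_ln 1 $ j * y ^ j\<bar>\<^sub>p \<le> 1 / real p" for j
    using padic_abs_ln_term_le(2)[OF assms, of j] abs_eq[of j] by (cases "j = 0") auto
  let ?t = "\<lambda>n. (-1) ^ n * ((1 + y) - 1) ^ Suc n / of_nat (Suc n)"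
  have t: "?t n = fps_ln 1 $ Suc n * y ^ Suc n" for n
    by (simp add: fps_ln_nth)
  have "(\<lambda>n. real (Suc n) * (1 / real p) ^ Suc n) \<longlonglongrightarrow> 0"
    using powser_times_n_limit_0[of "1 / real p"] p_ge_3 by (intro LIMSEQ_Suc) simp
  then have "(\<lambda>n. \<bar>?t n\<bar>\<^sub>p) \<longlonglongrightarrow> 0"
    unfolding t
    by (rule real_null_squeeze[rotated -1])
       (use padic_abs_ln_term_le(1)[OF assms, of "Suc _"] in
         \<open>auto simp: abs_eq simp del: power_Suc of_nat_Suc\<close>)
  then have "?t sums log_p (1 + y)"
    unfolding log_p_def by (intro summable_sums summable_padic)
  \<comment> \<open>The terms of \<open>log_p\<close> are indexed from 0 but start at degree 1; the
    inserted zero is the constant coefficient of \<open>fps_ln 1\<close>.\<close>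
  from sums_padic_shift[OF this, of 1] have "(\<lambda>n. if 1 \<le> n then ?t (n - 1) else 0) sums log_p (1 + y)" .
  also have "(\<lambda>n. if 1 \<le> n then ?t (n - 1) else 0) = (\<lambda>j. fps_ln 1 $ j * y ^ j)"
    unfolding t by (auto simp: fun_eq_iff not_le)
  finally show sums: "(\<lambda>j. fps_ln 1 $ j * y ^ j) sums log_p (1 + y)" .
  show "\<bar>log_p (1 + y)\<bar>\<^sub>p \<le> 1 / real p"
    by (rule padic_abs_sums_le[OF sums le])
qed

text \<open>The case \<open>n = 1\<close> says that \<open>fps_ln 1\<close> inverts
  \<open>fps_exp 1 - 1\<close>; the general case follows by taking powers, with which composition
  commutes.\<close>

lemma fps_exp_compose_ln: "fps_exp (of_nat n) oo fps_ln 1 = (1 + fps_X :: 'a fps) ^ n"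
proof -
  have "(fps_exp 1 - 1) oo fps_ln 1 = (fps_X :: 'a fps)"
    by (subst fps_ln_fps_exp_inv) (auto intro!: fps_inv_right)
  then have "fps_exp 1 oo fps_ln 1 = (1 + fps_X :: 'a fps)"
    by (simp add: fps_compose_sub_distrib algebra_simps)
  moreover have "fps_exp (of_nat n) = (fps_exp 1 :: 'a fps) ^ n"
    by (simp add: fps_exp_power_mult)
  ultimately show ?thesis
    by (simp flip: fps_compose_power)
qed

text \<open>The formal identity passes to values by substitution with \<open>\<rho> = 1 / p\<close>:
  the coefficient \<open>n ^ k / fact k\<close> times \<open>\<rho> ^ k\<close> is at most
  \<open>rate ^ k\<close>, because an integer has absolute value at most 1.\<close>

lemma exp_p_of_nat_log_p:
  assumes "\<bar>x - 1 :: 'a\<bar>\<^sub>p \<le> 1 / real p"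
  shows "exp_p (of_nat n * log_p x) = x ^ n"
proof -
  define y where "y = x - 1"
  have y: "\<bar>y\<bar>\<^sub>p \<le> 1 / real p" and x: "x = 1 + y"
    using assms by (auto simp: y_def)
  have "\<bar>fps_exp (of_nat n :: 'a) $ k\<bar>\<^sub>p * (1 / real p) ^ k \<le> rate ^ k" for k
  proof -
    have "\<bar>of_nat n :: 'a\<bar>\<^sub>p ^ k * \<bar>1 / fact k :: 'a\<bar>\<^sub>p \<le> 1 * root_p ^ k"
      using padic_abs_inverse_fact_le padic_abs_of_nat_le
      by (intro mult_mono power_le_one) auto
    then show ?thesis
      using p_ge_3 by (simp add: padic_abs_divide padic_abs_power rate_def power_divide field_simps)
  qed
  moreover have "(\<lambda>k. rate ^ k) \<longlonglongrightarrow> 0"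
    using rate_pos rate_less_1 by (intro LIMSEQ_power_zero) simp
  ultimately have null: "(\<lambda>k. \<bar>fps_exp (of_nat n :: 'a) $ k\<bar>\<^sub>p * (1 / real p) ^ k) \<longlonglongrightarrow> 0"
    by - (rule real_null_squeeze, auto)
  obtain w where w: "(\<lambda>k. fps_exp (of_nat n) $ k * log_p x ^ k) sums w"
    "(\<lambda>j. (fps_exp (of_nat n) oo fps_ln 1) $ j * y ^ j) sums w"
    unfolding x
    by (rule fps_sums_padic_compose[OF fps_ln_0 log_p_sums(1,2)[OF y] null])
  have "(\<lambda>j. (1 + fps_X :: 'a fps) $ j * y ^ j) sums x"
    using sums_finite[of "{0, 1}" "\<lambda>j. (1 + fps_X :: 'a fps) $ j * y ^ j"] by (simp add: x)
  then have "w = x ^ n"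
    using w(2) fps_sums_padic_power sums_unique2 unfolding fps_exp_compose_ln by blast
  moreover have "(\<lambda>k. (of_nat n * log_p x) ^ k / fact k) sums w"
    using w(1) by (simp add: power_mult_distrib)
  then have "exp_p (of_nat n * log_p x) = w"
    by (simp add: exp_p_def sums_unique[symmetric])
  ultimately show ?thesis
    by simp
qed

section \<open>Teichmueller representatives\<close>

lemma padic_abs_root_of_unity:
  assumes "x ^ (p - 1) = (1 :: 'a)"
  shows "\<bar>x\<bar>\<^sub>p = 1"
proof (rule power_eq_imp_eq_base)
  show "\<bar>x\<bar>\<^sub>p ^ (p - 1) = 1 ^ (p - 1)"
    using assms by (simp del: One_nat_def flip: padic_abs_power)
qed (use p_ge_3 in auto)

text \<open>If \<open>u \<noteq> 1\<close>, the geometric sum of the powers of \<open>u\<close>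
  vanishes. Comparing each power with 1 then shows that \<open>p - 1\<close> is at most as large as
  \<open>u - 1\<close>, although \<open>p - 1\<close> is prime to \<open>p\<close>.\<close>

lemma root_of_unity_eq_1:
  assumes u: "u ^ (p - 1) = (1 :: 'a)" and "\<bar>u - 1\<bar>\<^sub>p < 1"
  shows "u = 1"
proof (rule ccontr)
  assume "u \<noteq> 1"
  have "\<bar>u\<bar>\<^sub>p = 1"
    by (rule padic_abs_root_of_unity[OF u])
  have "(\<Sum>i<p - 1. u ^ i) = 0"
    using power_diff_1_eq[of u "p - 1"] u \<open>u \<noteq> 1\<close> by simp
  then have "(\<Sum>i<p - 1. u ^ i - 1) = - of_nat (p - 1)"
    using p_ge_3 by (simp add: sum_subtractf)
  then have "\<bar>of_nat (p - 1) :: 'a\<bar>\<^sub>p = \<bar>\<Sum>i<p - 1. u ^ i - 1\<bar>\<^sub>p"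
    by (metis padic_abs_minus)
  also have "\<dots> \<le> \<bar>u - 1\<bar>\<^sub>p"
  proof (rule padic_abs_sum_le)
    fix i
    have "u ^ i - 1 = (u - 1) * (\<Sum>j<i. u ^ j)"
      by (rule power_diff_1_eq)
    moreover have "\<bar>\<Sum>j<i. u ^ j\<bar>\<^sub>p \<le> 1"
      using \<open>\<bar>u\<bar>\<^sub>p = 1\<close> by (intro padic_abs_sum_le) (auto simp: padic_abs_power)
    ultimately show "\<bar>u ^ i - 1\<bar>\<^sub>p \<le> \<bar>u - 1\<bar>\<^sub>p"
      using mult_left_mono[of "\<bar>\<Sum>j<i. u ^ j\<bar>\<^sub>p" 1 "\<bar>u - 1\<bar>\<^sub>p"] by (simp add: padic_abs_mult)
  qed simp
  also have "\<dots> < 1" by fact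
  finally have "\<bar>of_nat (p - 1) :: 'a\<bar>\<^sub>p < 1" .
  moreover have "\<not> p dvd p - 1"
    using p_ge_3 by (intro nat_dvd_not_less) auto
  ultimately show False
    using padic_abs_of_nat_eq_1 by fastforce
qed

lemma root_of_unity_unique:
  assumes "x ^ (p - 1) = (1 :: 'a)" "y ^ (p - 1) = 1" "\<bar>x - y\<bar>\<^sub>p < 1"
  shows "x = y"
proof -
  have y: "y \<noteq> 0"
    using assms(2) p_ge_3 by (auto simp: power_0_left)
  have "\<bar>y\<bar>\<^sub>p = 1"
    by (rule padic_abs_root_of_unity[OF assms(2)])
  moreover have "x / y - 1 = (x - y) / y"
    using y by (simp add: field_simps)
  ultimately have "\<bar>x / y - 1\<bar>\<^sub>p < 1"
    using assms(3) by (simp add: padic_abs_divide)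
  then have "x / y = 1"
    using root_of_unity_eq_1[of "x / y"] assms(1,2) by (simp only: power_divide) simp
  then show ?thesis
    using y by simp
qed

lemma tendsto_padic_power:
  assumes "(f :: nat \<Rightarrow> 'a) \<longlonglongrightarrow> l"
  shows "(\<lambda>n. f n ^ k) \<longlonglongrightarrow> l ^ k"
proof (induction k)
  case (Suc k)
  have "(\<lambda>n. (f n - l) * (f n ^ k - l ^ k)) \<longlonglongrightarrow> 0"
    using assms Suc tendsto_mult[of "\<lambda>n. \<bar>f n - l\<bar>\<^sub>p" 0]
    by (fastforce simp: tendsto_padic_iff padic_abs_mult)
  \<comment> \<open>Expanding the null product leaves, beside the desired power, only scalar
    multiples of sequences with known limits. This yields the product limit from the limit laws at
    hand.\<close>
  then have "(\<lambda>n. (f n - l) * (f n ^ k - l ^ k) + (l * f n ^ k + (l ^ k * f n + (- 1) * (l * l ^ k))))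
      \<longlonglongrightarrow> 0 + (l * l ^ k + (l ^ k * l + (- 1) * (l * l ^ k)))"
    using assms Suc by (intro tendsto_padic_add tendsto_padic_cmult) auto
  then show ?case
    by (simp add: algebra_simps)
qed simp

text \<open>The two exponents differ by the totient of \<open>p ^ Suc n\<close>, so Euler's theorem
  applies. The congruence makes consecutive members of the sequence \<open>b ^ p ^ n\<close>
  p-adically close.\<close>

lemma power_prime_power_cong:
  assumes "coprime b p"
  shows "[b ^ p ^ Suc n = b ^ p ^ n] (mod p ^ Suc n)"
proof -
  have "coprime b (p ^ Suc n)"
    using assms by (simp add: coprime_power_right_iff del: power_Suc)
  then have "[b ^ totient (p ^ Suc n) = 1] (mod p ^ Suc n)"
    by (rule euler_theorem)
  then have "[b ^ p ^ n * b ^ (p ^ n * (p - 1)) = b ^ p ^ n * 1] (mod p ^ Suc n)"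
    unfolding totient_prime_power_Suc[OF prime_p] by (intro cong_mult cong_refl)
  moreover have "p ^ Suc n = p ^ n + p ^ n * (p - 1)"
    using p_ge_3 by (cases p) auto
  ultimately show ?thesis
    by (metis mult.right_neutral power_add)
qed

text \<open>The representative is the limit of the sequence \<open>b ^ p ^ n\<close>.\<close>

lemma teichmueller_exists:
  assumes a: "\<not> int p dvd a"
  shows "\<exists>x\<in>Zp. x ^ (p - 1) = (1 :: 'a) \<and> (\<exists>y\<in>Zp. x - of_int a = of_nat p * y)"
proof -
  define b where "b = nat (a mod int p)"
  have b: "int b = a mod int p"
    using p_ge_3 by (simp add: b_def)
  have "\<not> p dvd b"
    using a b by (metis dvd_mod_iff dvd_refl int_dvd_int_iff)
  then have cop: "coprime b p"
    using prime_imp_coprime[OF prime_p] by (simp add: coprime_commute)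
  define u :: "nat \<Rightarrow> 'a" where "u n = of_nat b ^ p ^ n" for n
  have "\<bar>u (Suc n) - u n\<bar>\<^sub>p \<le> (1 / real p) ^ Suc n" for n
  proof -
    have "[int (b ^ p ^ Suc n) = int (b ^ p ^ n)] (mod int (p ^ Suc n))"
      using power_prime_power_cong[OF cop] by (simp only: cong_int_iff)
    then have "int p ^ Suc n dvd int (b ^ p ^ Suc n) - int (b ^ p ^ n)"
      by (simp add: cong_iff_dvd_diff)
    from padic_abs_of_int_dvd_le[OF this] show ?thesis
      by (simp add: u_def)
  qed
  note diff = this
  have "(\<lambda>n. (1 / real p) ^ Suc n) \<longlonglongrightarrow> 0"
    using inverse_p_less_1 by (intro LIMSEQ_Suc LIMSEQ_power_zero) simp
  then have "summable (\<lambda>n. u (Suc n) - u n)"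
    by (rule summable_padic[OF real_null_squeeze[OF padic_abs_nonneg diff]])
  then obtain S where S: "(\<lambda>n. u (Suc n) - u n) sums S"
    by (auto simp: summable_def)
  have "\<bar>S\<bar>\<^sub>p \<le> 1 / real p"
  proof (rule padic_abs_sums_le[OF S])
    fix n
    have "(1 / real p) ^ Suc n \<le> (1 / real p) ^ 1"
      using inverse_p_less_1 by (intro power_decreasing) auto
    then show "\<bar>u (Suc n) - u n\<bar>\<^sub>p \<le> 1 / real p"
      using diff[of n] by simp
  qed
  \<comment> \<open>Since \<open>u 0\<close> is \<open>b\<close>, telescoping makes \<open>x\<close>
    the limit of \<open>u\<close>, and the bound on \<open>S\<close> keeps \<open>x\<close>
    congruent to \<open>b\<close>. Raising to the power \<open>p\<close> shifts the sequence, so the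
    limit satisfies \<open>x ^ p = x\<close>.\<close>
  define x where "x = of_nat b + S"
  have sum_u: "(\<Sum>i<n. u (Suc i) - u i) = u n - of_nat b" for n
    using sum_lessThan_telescope[of u n] by (simp add: u_def)
  have "(\<lambda>n. of_nat b + (\<Sum>i<n. u (Suc i) - u i)) \<longlonglongrightarrow> x"
    unfolding x_def using S by (intro tendsto_padic_add) (auto simp: sums_def)
  then have u: "u \<longlonglongrightarrow> x"
    by (simp add: sum_u)
  have "(\<lambda>n. u n ^ p) \<longlonglongrightarrow> x ^ p"
    by (intro tendsto_padic_power u)
  moreover have "u n ^ p = u (Suc n)" for n
    by (simp add: u_def mult.commute flip: power_mult)
  ultimately have "x ^ p = x"
    using LIMSEQ_Suc[OF u] LIMSEQ_unique by simp
  have abs_b: "\<bar>of_nat b :: 'a\<bar>\<^sub>p = 1"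
    using \<open>\<not> p dvd b\<close> by (rule padic_abs_of_nat_eq_1)
  have "x \<noteq> 0"
  proof
    assume "x = 0"
    then have "\<bar>S\<bar>\<^sub>p = \<bar>of_nat b :: 'a\<bar>\<^sub>p"
      by (metis add_eq_0_iff padic_abs_minus x_def)
    then show False
      using abs_b \<open>\<bar>S\<bar>\<^sub>p \<le> 1 / real p\<close> inverse_p_less_1 by simp
  qed
  have "x * x ^ (p - 1) = x * 1"
    using \<open>x ^ p = x\<close> p_ge_3 by (cases p) auto
  then have x1: "x ^ (p - 1) = 1"
    using \<open>x \<noteq> 0\<close> by (metis mult_left_cancel)
  have "x \<in> Qp"
    unfolding Qp_def closure_sequential using u by (intro exI[of _ u]) (auto simp: u_def)
  then have "x \<in> Zp"
    using padic_abs_root_of_unity[OF x1] by (simp add: Zp_def)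
  have xa: "x - of_int a = S + of_int (int b - a)"
    by (simp add: x_def)
  \<comment> \<open>The cofactor lies in \<open>Qp\<close> as a limit of the rationals
    \<open>(u n - a) / p\<close>; membership in \<open>Zp\<close> is then a matter of size.\<close>
  define y where "y = (x - of_int a) / of_nat p"
  have "(\<lambda>n. (1 / of_nat p) * (u n + (- of_int a))) \<longlonglongrightarrow> (1 / of_nat p) * (x + (- of_int a))"
    by (intro tendsto_padic_cmult tendsto_padic_add u tendsto_const)
  then have "y \<in> Qp"
    unfolding Qp_def closure_sequential
    by (intro exI[of _ "\<lambda>n. (1 / of_nat p) * (u n + (- of_int a))"]) (auto simp: u_def y_def)
  moreover have "\<bar>of_int (int b - a) :: 'a\<bar>\<^sub>p \<le> (1 / real p) ^ 1"
  proof (rule padic_abs_of_int_dvd_le)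
    show "int p ^ 1 dvd int b - a"
      unfolding b by (simp add: mod_eq_dvd_iff[symmetric])
  qed
  then have "\<bar>x - of_int a\<bar>\<^sub>p \<le> 1 / real p"
    unfolding xa using padic_abs_add[of S "of_int (int b - a)"] \<open>\<bar>S\<bar>\<^sub>p \<le> 1 / real p\<close> by simp
  then have "\<bar>y\<bar>\<^sub>p \<le> 1"
    using p_ge_3 by (simp add: y_def padic_abs_divide padic_abs_p field_simps)
  moreover have "x - of_int a = of_nat p * y"
    using p_ge_3 by (simp add: y_def)
  ultimately show ?thesis
    using \<open>x \<in> Zp\<close> x1 by (auto simp: Zp_def)
qed

text \<open>The definite description is legitimate because two candidates differ by at most
  \<open>1 / p\<close>, which distinct roots of unity of order dividing \<open>p - 1\<close>
  cannot.\<close>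

lemma
  assumes a: "\<not> int p dvd a"
  shows teichmueller_power: "teichmueller p a ^ (p - 1) = (1 :: 'a)"
    and teichmueller_diff: "\<bar>teichmueller p a - of_int a :: 'a\<bar>\<^sub>p \<le> 1 / real p"
proof -
  let ?P = "\<lambda>x :: 'a. x \<in> Zp \<and> x ^ (p - 1) = 1 \<and> (\<exists>y\<in>Zp. x - of_int a = of_nat p * y)"
  have le: "\<bar>x - of_int a\<bar>\<^sub>p \<le> 1 / real p" if "?P x" for x
    using that by (auto simp: Zp_def padic_abs_mult padic_abs_p divide_right_mono)
  have "\<exists>!x. ?P x"
  proof (rule ex_ex1I)
    show "\<exists>x. ?P x"
      using teichmueller_exists[OF a] by blast
    fix x y assume xy: "?P x" "?P y"
    have "\<bar>x - y\<bar>\<^sub>p \<le> 1 / real p"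
      using padic_abs_diff[of "x - of_int a" "y - of_int a"] le[OF xy(1)] le[OF xy(2)] by simp
    then show "x = y"
      using xy inverse_p_less_1 root_of_unity_unique[of x y] by linarith
  qed
  then have "?P (THE x. ?P x)"
    by (rule theI')
  then have "?P (teichmueller p a)"
    using a by (simp add: teichmueller_def)
  then show "teichmueller p a ^ (p - 1) = (1 :: 'a)" "\<bar>teichmueller p a - of_int a :: 'a\<bar>\<^sub>p \<le> 1 / real p"
    using le by auto
qed

text \<open>Closeness to \<open>a\<close> singles out one such root of unity in the whole field, so
  multiplicativity and periodicity reduce to estimates.\<close>

lemma teichmueller_eqI:
  assumes "\<not> int p dvd a" "x ^ (p - 1) = (1 :: 'a)" "\<bar>x - of_int a\<bar>\<^sub>p \<le> 1 / real p"
  shows "teichmueller p a = x"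
proof (rule root_of_unity_unique)
  show "\<bar>teichmueller p a - x\<bar>\<^sub>p < 1"
    using padic_abs_diff[of "teichmueller p a - of_int a" "x - of_int a"]
      teichmueller_diff[OF assms(1)] assms(3) inverse_p_less_1 by simp
qed (use assms teichmueller_power in auto)

lemma padic_abs_teichmueller:
  assumes "\<not> int p dvd a"
  shows "\<bar>teichmueller p a :: 'a\<bar>\<^sub>p = 1"
  using padic_abs_root_of_unity[OF teichmueller_power[OF assms]] .

lemma teichmueller_nonzero: "\<not> int p dvd a \<Longrightarrow> (teichmueller p a :: 'a) \<noteq> 0"
  using padic_abs_teichmueller by fastforce

lemma teichmueller_mult:
  "teichmueller p (a * b) = (teichmueller p a * teichmueller p b :: 'a)"
proof (cases "int p dvd a \<or> int p dvd b")
  case False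
  let ?t = "teichmueller p :: int \<Rightarrow> 'a"
  have "\<not> int p dvd a * b"
    using False prime_p by (simp add: prime_dvd_mult_iff)
  then show ?thesis
  proof (rule teichmueller_eqI)
    show "(?t a * ?t b) ^ (p - 1) = 1"
      using False by (simp add: power_mult_distrib teichmueller_power del: One_nat_def)
    have "?t a * ?t b - of_int (a * b) = ?t a * (?t b - of_int b) + (?t a - of_int a) * of_int b"
      by (simp add: algebra_simps)
    moreover have "\<bar>?t a * (?t b - of_int b)\<bar>\<^sub>p \<le> 1 / real p"
      using False by (simp add: padic_abs_mult padic_abs_teichmueller teichmueller_diff)
    moreover have "\<bar>(?t a - of_int a) * of_int b\<bar>\<^sub>p \<le> 1 / real p"
      using False by (simp add: padic_abs_mult padic_abs_of_int_eq_1 teichmueller_diff)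
    ultimately show "\<bar>?t a * ?t b - of_int (a * b)\<bar>\<^sub>p \<le> 1 / real p"
      using padic_abs_add[of "?t a * (?t b - of_int b)" "(?t a - of_int a) * of_int b"] by simp
  qed
qed (auto simp: teichmueller_def)

lemma teichmueller_1: "teichmueller p 1 = (1 :: 'a)"
  using p_ge_3 by (intro teichmueller_eqI) auto

lemma teichmueller_cong:
  assumes "[a = b] (mod int p)"
  shows "teichmueller p a = (teichmueller p b :: 'a)"
proof (cases "int p dvd b")
  case True
  then have "int p dvd a"
    using assms cong_dvd_iff by blast
  then show ?thesis
    using True by (simp add: teichmueller_def)
next
  case False
  then have a: "\<not> int p dvd a"
    using assms cong_dvd_iff by blast
  let ?t = "teichmueller p b :: 'a"
  show ?thesis
  proof (rule teichmueller_eqI[OF a])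
    have "\<bar>of_int (b - a) :: 'a\<bar>\<^sub>p \<le> (1 / real p) ^ 1"
      using assms by (intro padic_abs_of_int_dvd_le) (simp add: cong_iff_dvd_diff dvd_diff_commute)
    then show "\<bar>?t - of_int a\<bar>\<^sub>p \<le> 1 / real p"
      using padic_abs_add[of "?t - of_int b" "of_int (b - a)"] teichmueller_diff[OF False] by simp
  qed (use False teichmueller_power in auto)
qed

lemma angle_minus_1:
  assumes "\<not> int p dvd a"
  shows "\<bar>angle p a - 1 :: 'a\<bar>\<^sub>p \<le> 1 / real p"
proof -
  have "angle p a - 1 = (of_int a - teichmueller p a :: 'a) / teichmueller p a"
    using teichmueller_nonzero[OF assms] by (simp add: angle_def diff_divide_distrib)
  moreover have "\<bar>of_int a - teichmueller p a :: 'a\<bar>\<^sub>p = \<bar>teichmueller p a - of_int a :: 'a\<bar>\<^sub>p"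
    by (metis minus_diff_eq padic_abs_minus)
  ultimately show ?thesis
    using teichmueller_diff[OF assms] padic_abs_teichmueller[OF assms] by (simp add: padic_abs_divide)
qed

lemma angle_pow_of_nat:
  "\<not> int p dvd a \<Longrightarrow> angle_pow p a (of_nat n) = (angle p a ^ n :: 'a)"
  unfolding angle_pow_def by (intro exp_p_of_nat_log_p angle_minus_1)

lemma padic_abs_log_p_angle:
  "\<not> int p dvd a \<Longrightarrow> \<bar>log_p (angle p a) :: 'a\<bar>\<^sub>p \<le> 1 / real p"
  using log_p_sums(3)[OF angle_minus_1] by simp

section \<open>Integrality of the multiple Euler numbers\<close>

definition hurwitz_integral :: "rat fps \<Rightarrow> bool" where
  "hurwitz_integral f \<longleftrightarrow> (\<forall>m. \<bar>of_rat (fact m * f $ m) :: 'a\<bar>\<^sub>p \<le> 1)"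

lemma hurwitz_integral_mult:
  assumes "hurwitz_integral f" "hurwitz_integral g"
  shows "hurwitz_integral (f * g)"
  unfolding hurwitz_integral_def fps_mult_nth_fact of_rat_sum
proof (intro allI padic_abs_sum_le)
  fix m i
  have "\<bar>of_nat (m choose i) :: 'a\<bar>\<^sub>p * \<bar>of_rat (fact i * f $ i) :: 'a\<bar>\<^sub>p *
      \<bar>of_rat (fact (m - i) * g $ (m - i)) :: 'a\<bar>\<^sub>p \<le> 1 * 1 * 1"
    using assms padic_abs_of_nat_le unfolding hurwitz_integral_def by (intro mult_mono) auto
  then show "\<bar>of_rat (of_nat (m choose i) * (fact i * f $ i) * (fact (m - i) * g $ (m - i))) :: 'a\<bar>\<^sub>p \<le> 1"
    by (simp add: of_rat_mult padic_abs_mult)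
qed auto

lemma hurwitz_integral_power:
  assumes "hurwitz_integral f"
  shows "hurwitz_integral (f ^ n)"
proof (induction n)
  case 0
  then show ?case
    by (simp add: hurwitz_integral_def fps_one_def)
next
  case (Suc n)
  then show ?case
    using hurwitz_integral_mult[OF assms] by simp
qed

text \<open>Multiplying by the denominator gives a recursion for \<open>2 * e m\<close> with integer
  coefficients in the earlier \<open>e i\<close>. The factor 2 has absolute value 1 because
  \<open>p\<close> is odd, so integrality propagates.\<close>

lemma hurwitz_integral_euler: "hurwitz_integral (2 / (fps_exp 1 + 1))"
proof -
  define G D :: "rat fps" where "G = 2 / (fps_exp 1 + 1)" and "D = fps_exp 1 + 1"
  have D0: "D $ 0 \<noteq> 0"
    by (simp add: D_def)
  then have "G * D = 2"
    using inverse_mult_eq_1[OF D0] by (simp add: G_def flip: D_def)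
  define e where "e i = fact i * G $ i" for i
  have D: "fact j * D $ j = 1 + (if j = 0 then 1 else 0)" for j
    by (simp add: D_def distrib_left)
  have rec: "2 * e m = (if m = 0 then 2 else 0) - (\<Sum>i<m. of_nat (m choose i) * e i)" for m
  proof -
    have "(if m = 0 then 2 else 0 :: rat) = fact m * (G * D) $ m"
      unfolding \<open>G * D = 2\<close> by (simp add: fps_numeral_nth)
    also have "\<dots> = (\<Sum>i=0..m. of_nat (m choose i) * e i * (1 + (if m - i = 0 then 1 else 0)))"
      unfolding fps_mult_nth_fact D by (simp add: e_def)
    also have "{0..m} = insert m {..<m}"
      by auto
    also have "(\<Sum>i\<in>\<dots>. of_nat (m choose i) * e i * (1 + (if m - i = 0 then 1 else 0))) =
        2 * e m + (\<Sum>i<m. of_nat (m choose i) * e i)"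
      by (subst sum.insert) auto
    finally show ?thesis
      by simp
  qed
  have abs2: "\<bar>2 :: 'a\<bar>\<^sub>p = 1"
    using padic_abs_of_nat_eq_1[of 2] p_ge_3 nat_dvd_not_less[of 2 p] by auto
  have "\<bar>of_rat (e m) :: 'a\<bar>\<^sub>p \<le> 1" for m
  proof (induction m rule: less_induct)
    case (less m)
    have "\<bar>of_rat (2 * e m) :: 'a\<bar>\<^sub>p \<le> max \<bar>of_rat (if m = 0 then 2 else 0) :: 'a\<bar>\<^sub>p
        \<bar>of_rat (\<Sum>i<m. of_nat (m choose i) * e i) :: 'a\<bar>\<^sub>p"
      unfolding rec of_rat_diff by (rule padic_abs_diff)
    moreover have "\<bar>of_rat (if m = 0 then 2 else 0) :: 'a\<bar>\<^sub>p \<le> 1"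
      by (simp add: abs2)
    moreover have "\<bar>of_rat (\<Sum>i<m. of_nat (m choose i) * e i) :: 'a\<bar>\<^sub>p \<le> 1"
      unfolding of_rat_sum
      using less padic_abs_of_nat_le
      by (intro padic_abs_sum_le) (auto simp: of_rat_mult padic_abs_mult intro!: mult_le_one)
    ultimately show ?case
      by (simp add: of_rat_mult padic_abs_mult abs2)
  qed
  then show ?thesis
    by (simp add: hurwitz_integral_def e_def G_def)
qed

lemma padic_abs_euler_number_le: "\<bar>of_rat (euler_number r m) :: 'a\<bar>\<^sub>p \<le> 1"
  using hurwitz_integral_power[OF hurwitz_integral_euler]
  by (simp add: hurwitz_integral_def euler_number_def)

end

section \<open>Primitive characters\<close>

text \<open>Adding \<open>d * t\<close> works, with \<open>t\<close> the product of the primes of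
  \<open>M\<close> not dividing \<open>a\<close>: such a prime divides \<open>d * t\<close> but not
  \<open>a\<close>, while a prime of \<open>M\<close> dividing \<open>a\<close> divides neither
  \<open>d\<close> nor \<open>t\<close>.\<close>

lemma coprime_lift_int:
  fixes a d M :: int
  assumes "coprime a d" "M \<noteq> 0"
  obtains b where "[b = a] (mod d)" "coprime b M"
proof -
  define t where "t = \<Prod>{q \<in> prime_factors M. \<not> q dvd a}"
  have "coprime (a + d * t) M"
  proof (rule ccontr)
    assume "\<not> coprime (a + d * t) M"
    then have "\<not> is_unit (gcd (a + d * t) M)"
      by (simp add: coprime_iff_gcd_eq_1)
    moreover have "gcd (a + d * t) M \<noteq> 0"
      using assms(2) by simp
    ultimately obtain q where q: "prime q" "q dvd gcd (a + d * t) M"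
      using prime_divisor_exists by blast
    then have q_in: "q \<in> prime_factors M"
      using assms(2) by (auto simp: prime_factors_dvd)
    show False
    proof (cases "q dvd a")
      case True
      then have "q dvd d * t"
        using q by (metis dvd_add_right_iff dvd_trans gcd_dvd1)
      moreover have "\<not> q dvd d"
        using True assms(1) q(1) by (meson coprime_common_divisor not_prime_unit)
      ultimately obtain q' where "q' \<in> prime_factors M" "\<not> q' dvd a" "q dvd q'"
        using q(1) unfolding t_def by (auto simp: prime_dvd_mult_iff prime_dvd_prod_iff)
      then show False
        using True q(1) primes_dvd_imp_eq by (auto simp: prime_factors_dvd)
    next
      case False
      then have "q dvd t"
        using q_in unfolding t_def by (intro dvd_prodI) auto
      then have "q dvd a"
        using q by (metis dvd_add_left_iff dvd_mult dvd_trans gcd_dvd1)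
      then show False
        using False by simp
    qed
  qed
  moreover have "[a + d * t = a] (mod d)"
    by (simp add: cong_iff_dvd_diff)
  ultimately show ?thesis
    using that by blast
qed

text \<open>This is the Chinese remainder theorem for moduli with a common factor; a Bezout relation
  for the gcd gives the solution explicitly.\<close>

lemma cong_gcd_solution_int:
  fixes a b d e :: int
  assumes "[a = b] (mod gcd d e)"
  obtains x where "[x = a] (mod d)" "[x = b] (mod e)"
proof -
  obtain u v where uv: "u * d + v * e = gcd d e"
    using bezout_int by blast
  obtain k where k: "a - b = gcd d e * k"
    using assms by (auto simp: cong_iff_dvd_diff elim: dvdE)
  have eq: "a - u * d * k = b + v * e * k"
    using k by (simp add: algebra_simps flip: uv)
  have "[a - u * d * k = a] (mod d)"
    by (simp add: cong_iff_dvd_diff)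
  moreover have "[a - u * d * k = b] (mod e)"
    unfolding eq by (simp add: cong_iff_dvd_diff)
  ultimately show ?thesis
    using that by blast
qed

lemma dirichlet_character_cong:
  assumes "dirichlet_character N chi" "[a = b] (mod int N)"
  shows "chi a = chi b"
proof -
  have shift: "chi (c + int N * int k) = chi c" for c k
  proof (induction k)
    case (Suc k)
    have "chi ((c + int N * int k) + int N) = chi (c + int N * int k)"
      using assms(1) by (simp add: dirichlet_character_def)
    then show ?case
      using Suc by (simp add: algebra_simps)
  qed simp
  obtain k where k: "a = b + int N * k"
    using assms(2) by (metis cong_iff_lin cong_sym)
  show ?thesis
  proof (cases "0 \<le> k")
    case True
    then show ?thesis
      using shift[of b "nat k"] k by simp
  next
    case False
    then show ?thesis
      using shift[of a "nat (- k)"] k by simp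
  qed
qed

text \<open>Otherwise \<open>gcd d d'\<close> is a proper divisor of \<open>d\<close>, and
  primitivity supplies a unit \<open>a\<close>, congruent to 1 modulo this gcd, with
  \<open>\<psi> a \<noteq> 1\<close>. A number congruent to \<open>a\<close> modulo \<open>d\<close>
  and to 1 modulo \<open>d'\<close>, chosen prime to \<open>M\<close>, separates the
  characters.\<close>

lemma primitive_character_conductor_dvd:
  assumes psi: "primitive_character d \<psi>" and psi': "primitive_character d' \<psi>'"
    and dvd: "d dvd M" "d' dvd M" "M > 0"
    and eq: "\<And>a. coprime a (int M) \<Longrightarrow> \<psi> a = \<psi>' a"
  shows "d dvd d'"
proof (rule ccontr)
  assume "\<not> d dvd d'"
  have dpos: "d > 0"
    using dvd by (auto intro: dvd_pos_nat)
  have "gcd d d' dvd d" "gcd d d' \<noteq> d"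
    using \<open>\<not> d dvd d'\<close> by (auto, metis gcd_dvd2)
  then have "gcd d d' < d"
    using dpos by (metis dvd_imp_le le_neq_implies_less)
  with \<open>gcd d d' dvd d\<close> obtain a where a: "coprime a (int d)" "[a = 1] (mod int (gcd d d'))" "\<psi> a \<noteq> 1"
    using psi unfolding primitive_character_def by blast
  from a(2) obtain x where x: "[x = a] (mod int d)" "[x = 1] (mod int d')"
    using cong_gcd_solution_int[of a 1 "int d" "int d'"] by auto
  have "coprime x (int d)"
    using a(1) x(1) by (metis cong_imp_coprime cong_sym)
  moreover have "coprime x (int d')"
    using x(2) by (metis cong_imp_coprime cong_sym coprime_1_left)
  ultimately have cop: "coprime x (lcm (int d) (int d'))"
    using coprime_divisors[of x x "lcm (int d) (int d')" "int d * int d'"]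
    by (simp add: lcm_least del: lcm_int_int_eq)
  obtain b where b: "[b = x] (mod lcm (int d) (int d'))" "coprime b (int M)"
    using coprime_lift_int[OF cop, of "int M"] dvd(3) by auto
  have "[b = a] (mod int d)" "[b = 1] (mod int d')"
    using b(1) x by (meson cong_dvd_modulus cong_trans dvd_lcm1 dvd_lcm2)+
  then have "\<psi> b = \<psi> a" "\<psi>' b = \<psi>' 1"
    using psi psi' dirichlet_character_cong unfolding primitive_character_def by blast+
  moreover have "\<psi>' 1 = 1"
    using psi' by (simp add: primitive_character_def dirichlet_character_def)
  ultimately show False
    using eq[OF b(2)] a(3) by simp
qed

text \<open>Divisibility both ways gives equal conductors, and every unit modulo the conductor has a
  representative prime to \<open>M\<close>. This justifies the definite description in
  \<open>associated_primitive\<close>.\<close>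

lemma primitive_character_unique:
  assumes psi: "primitive_character d \<psi>" and psi': "primitive_character d' \<psi>'"
    and dvd: "d dvd M" "d' dvd M" "M > 0"
    and eq: "\<And>a. coprime a (int M) \<Longrightarrow> \<psi> a = \<psi>' a"
  shows "\<psi> = \<psi>'"
proof
  fix a
  have d: "d' = d"
    using primitive_character_conductor_dvd[OF psi psi' dvd eq]
      primitive_character_conductor_dvd[OF psi' psi dvd(2,1,3) eq[symmetric]]
    by (simp add: dvd_antisym)
  have chars: "dirichlet_character d \<psi>" "dirichlet_character d \<psi>'"
    using psi psi' by (auto simp: primitive_character_def d)
  show "\<psi> a = \<psi>' a"
  proof (cases "coprime a (int d)")
    case True
    obtain b where "[b = a] (mod int d)" "coprime b (int M)"
      using coprime_lift_int[OF True, of "int M"] dvd(3) by auto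
    then show ?thesis
      using chars eq dirichlet_character_cong by metis
  next
    case False
    then show ?thesis
      using chars unfolding dirichlet_character_def by metis
  qed
qed

text \<open>Take the least divisor \<open>d\<close> of \<open>M\<close> such that
  \<open>\<eta>\<close> is trivial on the units congruent to 1 modulo \<open>d\<close>. Then
  \<open>\<eta>\<close> factors through the units modulo \<open>d\<close>, and minimality is
  primitivity.\<close>

lemma primitive_character_exists:
  fixes \<eta> :: "int \<Rightarrow> 'a::field"
  assumes eta: "dirichlet_character M \<eta>"
  obtains d \<psi> where "d dvd M" "primitive_character d \<psi>" "\<And>a. coprime a (int M) \<Longrightarrow> \<psi> a = \<eta> a"
proof -
  have M: "M > 0" and eta_1: "\<eta> 1 = 1" and eta_mult: "\<eta> (a * b) = \<eta> a * \<eta> b"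
    and eta_0: "\<eta> a = 0 \<longleftrightarrow> \<not> coprime a (int M)" for a b
    using eta by (auto simp: dirichlet_character_def)
  define P where "P d \<longleftrightarrow> d dvd M \<and> (\<forall>a. coprime a (int M) \<longrightarrow> [a = 1] (mod int d) \<longrightarrow> \<eta> a = 1)" for d
  have "P M"
    using dirichlet_character_cong[OF eta] eta_1 unfolding P_def by auto
  define d where "d = (LEAST d. P d)"
  have "P d"
    unfolding d_def by (rule LeastI[of P, OF \<open>P M\<close>])
  then have dM: "d dvd M" and triv: "\<And>a. coprime a (int M) \<Longrightarrow> [a = 1] (mod int d) \<Longrightarrow> \<eta> a = 1"
    by (auto simp: P_def)
  have dpos: "d > 0"
    using dM M by (auto intro: dvd_pos_nat)
  have cop_d: "coprime a (int d)" if "coprime a (int M)" for a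
    using that dM by (meson coprime_divisors dvd_refl int_dvd_int_iff)
  \<comment> \<open>This makes the choice in \<open>\<psi>\<close> below immaterial: multiplying by
    an inverse \<open>c\<close> of \<open>b'\<close> modulo \<open>M\<close> moves both arguments to
    units congruent to 1 modulo \<open>d\<close>.\<close>
  have eta_cong: "\<eta> b = \<eta> b'" if b: "coprime b (int M)" "coprime b' (int M)" "[b = b'] (mod int d)" for b b'
  proof -
    obtain c where c: "[b' * c = 1] (mod int M)"
      using b(2) cong_solve_coprime_int by blast
    then have "coprime (b' * c) (int M)"
      by (metis cong_imp_coprime cong_sym coprime_1_left)
    then have cop_c: "coprime c (int M)"
      by simp
    have "[b * c = b' * c] (mod int d)"
      using b(3) by (rule cong_scalar_right)
    moreover have "[b' * c = 1] (mod int d)"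
      using c dM by (meson cong_dvd_modulus int_dvd_int_iff)
    ultimately have "[b * c = 1] (mod int d)"
      by (rule cong_trans)
    then have "\<eta> (b * c) = 1"
      using b(1) cop_c by (intro triv) auto
    moreover have "\<eta> (b' * c) = 1"
      using dirichlet_character_cong[OF eta c] eta_1 by simp
    ultimately show ?thesis
      using cop_c eta_0[of c] by (metis eta_mult mult_right_cancel)
  qed
  define \<psi> where "\<psi> a = (if coprime a (int d) then \<eta> (SOME b. coprime b (int M) \<and> [b = a] (mod int d)) else 0)" for a
  have psi: "\<psi> a = \<eta> b" if b: "coprime b (int M)" "[b = a] (mod int d)" for a b
  proof -
    have "coprime a (int d)"
      using b cop_d cong_imp_coprime by blast
    moreover have "coprime (SOME b. coprime b (int M) \<and> [b = a] (mod int d)) (int M) \<and>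
        [(SOME b. coprime b (int M) \<and> [b = a] (mod int d)) = a] (mod int d)"
      by (rule someI[of _ b]) (use b in blast)
    ultimately show ?thesis
      using b by (auto simp: \<psi>_def intro!: eta_cong) (meson cong_sym cong_trans)
  qed
  have lift: "\<exists>b. coprime b (int M) \<and> [b = a] (mod int d)" if "coprime a (int d)" for a
    using coprime_lift_int[OF that, of "int M"] M by fastforce
  have "dirichlet_character d \<psi>"
    unfolding dirichlet_character_def
  proof (intro conjI allI)
    show "d > 0" by fact
    show "\<psi> 1 = 1"
      using psi[of 1 1] eta_1 by simp
    show "\<psi> (a * b) = \<psi> a * \<psi> b" for a b
    proof (cases "coprime a (int d) \<and> coprime b (int d)")
      case True
      then obtain a' b' where ab: "coprime a' (int M)" "[a' = a] (mod int d)"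
        "coprime b' (int M)" "[b' = b] (mod int d)"
        using lift by meson
      then show ?thesis
        using psi[of a' a] psi[of b' b] psi[of "a' * b'" "a * b"] by (simp add: eta_mult cong_mult)
    next
      case False
      then show ?thesis
        by (auto simp: \<psi>_def)
    qed
    show "\<psi> (a + int d) = \<psi> a" for a
    proof -
      have cong: "[a + int d = a] (mod int d)"
        by (simp add: cong_iff_dvd_diff)
      have "coprime (a + int d) (int d) \<longleftrightarrow> coprime a (int d)"
        using cong cong_imp_coprime cong_sym by blast
      moreover have "[b = a + int d] (mod int d) \<longleftrightarrow> [b = a] (mod int d)" for b
        using cong cong_sym cong_trans by blast
      ultimately show ?thesis
        by (simp add: \<psi>_def)
    qed
    show "\<psi> a = 0 \<longleftrightarrow> \<not> coprime a (int d)" for a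
    proof (cases "coprime a (int d)")
      case True
      then show ?thesis
        using lift psi eta_0 by metis
    qed (simp add: \<psi>_def)
  qed
  moreover have "\<exists>a. coprime a (int d) \<and> [a = 1] (mod int e) \<and> \<psi> a \<noteq> 1" if "e dvd d" "e < d" for e
  proof -
    have "\<not> P e"
      using not_less_Least[of e P] \<open>e < d\<close> by (simp add: d_def)
    then obtain a where "coprime a (int M)" "[a = 1] (mod int e)" "\<eta> a \<noteq> 1"
      using dvd_trans[OF \<open>e dvd d\<close> dM] by (auto simp: P_def)
    then show ?thesis
      using psi[of a a] cop_d by (intro exI[of _ a]) auto
  qed
  ultimately have "primitive_character d \<psi>"
    by (simp add: primitive_character_def)
  then show ?thesis
    using that dM psi by simp
qed

lemma associated_primitive:
  assumes eta: "dirichlet_character M \<eta>"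
  obtains d where "d dvd M" "primitive_character d (associated_primitive M \<eta>)"
    "\<And>a. coprime a (int M) \<Longrightarrow> associated_primitive M \<eta> a = \<eta> a"
proof -
  let ?Q = "\<lambda>\<psi>. (\<exists>d. d dvd M \<and> primitive_character d \<psi>) \<and> (\<forall>a. coprime a (int M) \<longrightarrow> \<psi> a = \<eta> a)"
  obtain d \<psi> where psi: "d dvd M" "primitive_character d \<psi>" "\<And>a. coprime a (int M) \<Longrightarrow> \<psi> a = \<eta> a"
    using primitive_character_exists[OF eta] by blast
  have "M > 0"
    using eta by (simp add: dirichlet_character_def)
  have "?Q (associated_primitive M \<eta>)"
    unfolding associated_primitive_def
  proof (rule theI[of ?Q \<psi>])
    show "?Q \<psi>"
      using psi by blast
    fix \<phi> assume "?Q \<phi>"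
    then obtain e where "e dvd M" "primitive_character e \<phi>" "\<And>a. coprime a (int M) \<Longrightarrow> \<phi> a = \<eta> a"
      by blast
    then show "\<phi> = \<psi>"
      using psi \<open>M > 0\<close> by (intro primitive_character_unique[of e \<phi> d \<psi> M]) auto
  qed
  then show ?thesis
    using that by blast
qed

context padic_field
begin

section \<open>The twisted character\<close>

lemma dirichlet_character_twist:
  fixes chi :: "int \<Rightarrow> 'a"
  assumes chi: "dirichlet_character f chi"
  shows "dirichlet_character (f * p)
    (\<lambda>a. chi a * (if int p dvd a then 0 else teichmueller p a powi (- n)))"
proof -
  have cop: "coprime a (int p) \<longleftrightarrow> \<not> int p dvd a" for a
    using prime_p by (metis coprime_commute not_prime_unit prime_imp_coprime prime_nat_int_transfer
        coprime_absorb_left)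
  have chi_mod: "chi (a + int (f * p)) = chi a" for a
    by (rule dirichlet_character_cong[OF chi]) (simp add: cong_iff_dvd_diff)
  have dvd: "int p dvd a + int (f * p) \<longleftrightarrow> int p dvd a" for a
    by simp
  have teich: "teichmueller p (a + int (f * p)) = (teichmueller p a :: 'a)" for a
    by (rule teichmueller_cong) (simp add: cong_iff_dvd_diff)
  have dvd_mult: "int p dvd a * b \<longleftrightarrow> int p dvd a \<or> int p dvd b" for a b
    using prime_p by (simp add: prime_dvd_mult_iff)
  have "\<not> int p dvd 1"
    using p_ge_3 by simp
  then show ?thesis
    using chi p_ge_3 unfolding dirichlet_character_def chi_mod dvd teich
    by (auto simp: teichmueller_1 teichmueller_mult power_int_mult_distrib cop dvd_mult
        teichmueller_nonzero)
qed

text \<open>The formula for \<open>twist\<close> also covers arguments \<open>a\<close> that share a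
  prime \<open>q\<close> with \<open>f\<close>. There \<open>chi a = 0\<close>, and the twist
  vanishes too because \<open>q\<close> divides its conductor \<open>d\<close>: otherwise
  \<open>chi\<close> would be trivial on the units congruent to 1 modulo the part of
  \<open>f\<close> prime to \<open>q\<close>, against primitivity.\<close>

lemma
  fixes chi :: "int \<Rightarrow> 'a"
  assumes chi: "primitive_character f chi"
  shows twist_eq: "\<not> int p dvd a \<Longrightarrow> twist p f chi n a = chi a * teichmueller p a powi (- n)"
    and twist_mult: "twist p f chi n (b * c) = twist p f chi n b * twist p f chi n c"
proof -
  let ?psi = "twist p f chi n"
  have char: "dirichlet_character f chi"
    using chi by (simp add: primitive_character_def)
  obtain d where d: "d dvd f * p" "primitive_character d ?psi"
    "\<And>a. coprime a (int (f * p)) \<Longrightarrow>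
      ?psi a = chi a * (if int p dvd a then 0 else teichmueller p a powi (- n))"
    by (rule associated_primitive[OF dirichlet_character_twist[OF char, of n], folded twist_def]) blast
  have psi: "dirichlet_character d ?psi"
    using d(2) by (simp add: primitive_character_def)
  then show "?psi (b * c) = ?psi b * ?psi c"
    by (simp add: dirichlet_character_def)
  have cop_p: "coprime a (int p)" if "\<not> int p dvd a" for a
    using prime_p that by (metis coprime_commute prime_imp_coprime prime_nat_int_transfer)
  show "?psi a = chi a * teichmueller p a powi (- n)" if a: "\<not> int p dvd a"
  proof (cases "coprime a (int f)")
    case True
    then show ?thesis
      using d(3)[of a] a cop_p[OF a] by simp
  next
    case False
    then have "chi a = 0"
      using char by (simp add: dirichlet_character_def)
    have "f > 0"
      using char by (simp add: dirichlet_character_def)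
    have "\<not> is_unit (gcd a (int f))" "gcd a (int f) \<noteq> 0"
      using False \<open>f > 0\<close> by (auto simp: coprime_iff_gcd_eq_1)
    then obtain q' where q': "prime q'" "q' dvd gcd a (int f)"
      using prime_divisor_exists by blast
    define q where "q = nat q'"
    have int_q: "int q = q'"
      using prime_gt_0_int[OF q'(1)] by (simp add: q_def)
    then have "prime (int q)" "int q dvd a" "int q dvd int f"
      using q' by auto
    then have q: "prime q" "int q dvd a" "q dvd f"
      by (simp_all only: prime_nat_int_transfer int_dvd_int_iff)
    then have "q \<noteq> p"
      using a by blast
    then have "coprime q p"
      using q(1) prime_p by (simp add: primes_coprime)
    have "?psi a = 0"
    proof (rule ccontr)
      assume "?psi a \<noteq> 0"
      then have "coprime a (int d)"
        using psi by (simp add: dirichlet_character_def)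
      then have "coprime (int q) (int d)"
        using q(2) by (meson coprime_divisors dvd_refl)
      then have "coprime q d"
        by simp
      obtain f' where f': "f = q ^ multiplicity q f * f'" "\<not> q dvd f'"
        using multiplicity_decompose'[of f q] \<open>f > 0\<close> q(1) by (metis gr_implies_not0 not_prime_unit)
      define e where "e = multiplicity q f"
      note f' = f'[folded e_def]
      have "coprime q f'"
        using f'(2) q(1) by (simp add: prime_imp_coprime)
      have "f' dvd f"
        using f'(1) by (metis dvd_triv_right)
      moreover have "f' \<noteq> f"
        using f'(2) q(3) by auto
      ultimately have "f' < f"
        using \<open>f > 0\<close> by (simp add: dvd_imp_le le_neq_implies_less)
      then obtain c where c: "coprime c (int f)" "[c = 1] (mod int f')" "chi c \<noteq> 1"
        using chi \<open>f' dvd f\<close> unfolding primitive_character_def by blast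
      have "coprime (q ^ e) (f' * p)"
        using \<open>coprime q f'\<close> \<open>coprime q p\<close> by simp
      then have "gcd (int (q ^ e)) (int (f' * p)) = 1"
        by (simp only: coprime_iff_gcd_eq_1 gcd_int_int_eq of_nat_1)
      \<comment> \<open>This \<open>b\<close> agrees with \<open>c\<close> at \<open>q\<close> and
        with 1 elsewhere. It is congruent to \<open>c\<close> modulo \<open>f\<close>, so
        \<open>chi\<close> takes the same value there, while its Teichmueller factor is 1.\<close>
      then obtain b where b: "[b = c] (mod int (q ^ e))" "[b = 1] (mod int (f' * p))"
        by (metis cong_gcd_solution_int cong_1)
      have bf': "[b = 1] (mod int f')" and bp: "[b = 1] (mod int p)"
        using b(2) by (auto intro: cong_dvd_modulus simp del: of_nat_mult) 
      have "[b = c] (mod int f')"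
        using bf' c(2) by (meson cong_sym cong_trans)
      moreover have "coprime (int (q ^ e)) (int f')"
        using \<open>coprime q f'\<close> by simp
      ultimately have bc: "[b = c] (mod int f)"
        using coprime_cong_mult[OF b(1)] f'(1) by (metis of_nat_mult)
      then have "coprime b (int f)"
        using c(1) by (metis cong_imp_coprime cong_sym)
      moreover have "coprime b (int p)"
        using bp by (metis cong_imp_coprime cong_sym coprime_1_left)
      ultimately have "coprime b (int (f * p))"
        by simp
      have "\<not> int p dvd b"
        using bp cong_dvd_iff[OF bp] p_ge_3 by simp
      have "teichmueller p b = (1 :: 'a)"
        using teichmueller_cong[OF bp] by (simp add: teichmueller_1)
      then have "?psi b = chi b"
        using d(3)[OF \<open>coprime b (int (f * p))\<close>] \<open>\<not> int p dvd b\<close> by simp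
      also have "\<dots> = chi c"
        by (rule dirichlet_character_cong[OF char bc])
      finally have "?psi b \<noteq> 1"
        using c(3) by simp
      \<comment> \<open>Being prime to \<open>q\<close>, the conductor cannot see the only place
        where \<open>b\<close> differs from 1, so the twist at \<open>b\<close> is 1.\<close>
      moreover have "d dvd f' * p"
      proof -
        have "d dvd q ^ e * (f' * p)"
          using d(1) f'(1) by (metis mult.assoc)
        moreover have "coprime d (q ^ e)"
          using \<open>coprime q d\<close> by (simp add: coprime_commute)
        ultimately show ?thesis
          by (simp add: coprime_dvd_mult_right_iff)
      qed
      then have "[b = 1] (mod int d)"
        using b(2) by (meson cong_dvd_modulus int_dvd_int_iff)
      then have "?psi b = ?psi 1"
        by (rule dirichlet_character_cong[OF psi])
      moreover have "?psi 1 = 1"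
        using psi by (simp add: dirichlet_character_def)
      ultimately show False
        by simp
    qed
    then show ?thesis
      using \<open>chi a = 0\<close> by simp
  qed
qed

end

section \<open>Analyticity and interpolation\<close>

lemma euler_polynomial_expand:
  "euler_polynomial r n x = (\<Sum>i=0..n. of_nat (n choose i) * euler_number r i * x ^ (n - i))"
  unfolding euler_polynomial_def fps_mult_nth_fact euler_number_def by simp

text \<open>Written in powers of \<open>F / A\<close>, the value of the polynomial takes the shape
  of the inner series after it has terminated.\<close>

lemma euler_polynomial_homogeneous:
  assumes "A > 0" "F > 0"
  shows "(of_nat F ^ n * of_rat (euler_polynomial r n (of_nat A / of_nat F)) :: 'a::field_char_0) =
    of_nat A ^ n * (\<Sum>i=0..n. of_nat (n choose i) * (of_nat F / of_nat A) ^ i * of_rat (euler_number r i))"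
  unfolding euler_polynomial_expand of_rat_sum sum_distrib_left
proof (rule sum.cong)
  fix i assume "i \<in> {0..n}"
  then have "(of_nat F :: 'a) ^ n = of_nat F ^ i * of_nat F ^ (n - i)"
    "(of_nat A :: 'a) ^ n = of_nat A ^ i * of_nat A ^ (n - i)"
    by (simp_all flip: power_add)
  then show "(of_nat F ^ n * of_rat (of_nat (n choose i) * euler_number r i * (of_nat A / of_nat F) ^ (n - i)) :: 'a) =
      of_nat A ^ n * (of_nat (n choose i) * (of_nat F / of_nat A) ^ i * of_rat (euler_number r i))"
    using assms by (simp add: of_rat_mult of_rat_power of_rat_divide power_divide)
qed simp

context ultrametric_field
begin

section \<open>Closure properties of analytic functions on a disc\<close>

lemma analytic_on_disc_cmult:
  assumes "analytic_on_disc g R"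
  shows "analytic_on_disc (\<lambda>s. c * g s :: 'a) R"
proof -
  obtain b where "\<And>s. \<bar>s\<bar>\<^sub>p < R \<Longrightarrow> (\<lambda>k. b k * s ^ k) sums g s"
    using assms by (auto simp: analytic_on_disc_def)
  then have "\<forall>s. \<bar>s\<bar>\<^sub>p < R \<longrightarrow> (\<lambda>k. (c * b k) * s ^ k) sums (c * g s)"
    using sums_padic_cmult[of "\<lambda>k. b k * _ ^ k"] by (simp add: mult.assoc)
  then show ?thesis
    unfolding analytic_on_disc_def by (intro exI[of _ "\<lambda>k. c * b k"])
qed

lemma analytic_on_disc_sum:
  assumes "\<And>i. i \<in> A \<Longrightarrow> analytic_on_disc (g i) R"
  shows "analytic_on_disc (\<lambda>s. \<Sum>i\<in>A. g i s :: 'a) R"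
proof -
  obtain b where b: "\<And>i s. i \<in> A \<Longrightarrow> \<bar>s\<bar>\<^sub>p < R \<Longrightarrow> (\<lambda>k. b i k * s ^ k) sums g i s"
    using assms unfolding analytic_on_disc_def by metis
  have "\<forall>s. \<bar>s\<bar>\<^sub>p < R \<longrightarrow> (\<lambda>k. (\<Sum>i\<in>A. b i k) * s ^ k) sums (\<Sum>i\<in>A. g i s)"
    unfolding sum_distrib_right using b by (intro allI impI sums_padic_sum) auto
  then show ?thesis
    unfolding analytic_on_disc_def by (intro exI[of _ "\<lambda>k. \<Sum>i\<in>A. b i k"])
qed

lemma analytic_on_disc_mult:
  assumes "analytic_on_disc g R" "analytic_on_disc h R"
  shows "analytic_on_disc (\<lambda>s. g s * h s :: 'a) R"
proof -
  obtain b where b: "\<And>s. \<bar>s\<bar>\<^sub>p < R \<Longrightarrow> (\<lambda>k. b k * s ^ k) sums g s"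
    using assms(1) by (auto simp: analytic_on_disc_def)
  obtain c where c: "\<And>s. \<bar>s\<bar>\<^sub>p < R \<Longrightarrow> (\<lambda>k. c k * s ^ k) sums h s"
    using assms(2) by (auto simp: analytic_on_disc_def)
  have "\<forall>s. \<bar>s\<bar>\<^sub>p < R \<longrightarrow> (\<lambda>k. (Abs_fps b * Abs_fps c) $ k * s ^ k) sums (g s * h s)"
    using b c by (intro allI impI fps_sums_padic_mult) auto
  then show ?thesis
    unfolding analytic_on_disc_def by (intro exI[of _ "\<lambda>k. (Abs_fps b * Abs_fps c) $ k"])
qed

end

context padic_field
begin

section \<open>Analyticity of the l-function\<close>

lemma analytic_on_disc_angle_pow:
  assumes "\<not> int p dvd a"
  shows "analytic_on_disc (\<lambda>s :: 'a. angle_pow p a (- s)) (radius_D p)"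
  unfolding analytic_on_disc_def
proof (intro exI allI impI)
  fix s :: 'a assume "\<bar>s\<bar>\<^sub>p < radius_D p"
  then have "(\<lambda>k. (log_p (angle p a) ^ k / fact k) * (- s) ^ k) sums angle_pow p a (- s)"
    using exp_p_sums[OF padic_abs_log_p_angle[OF assms], of "- s"] by (simp add: angle_pow_def)
  then show "(\<lambda>k. ((- 1) ^ k * log_p (angle p a) ^ k / fact k) * s ^ k) sums angle_pow p a (- s)"
    by (simp add: power_minus[of s] mult_ac)
qed

text \<open>As a formal series in \<open>s\<close> this is \<open>fact m\<close> times the binomial
  coefficient of \<open>- s\<close> over \<open>m\<close>. Keeping it formal gives access to the
  coefficients needed for regrouping by powers of \<open>s\<close>.\<close>

definition falling_fps :: "nat \<Rightarrow> 'a fps" where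
  "falling_fps m = (\<Prod>i<m. - fps_X - fps_const (of_nat i))"

lemma falling_fps_sums: "(\<lambda>k. falling_fps m $ k * s ^ k) sums (\<Prod>i<m. - s - of_nat i)"
proof (induction m)
  case 0
  then show ?case
    using sums_finite[of "{0}" "\<lambda>k. (1 :: 'a fps) $ k * s ^ k"] by (simp add: falling_fps_def)
next
  case (Suc m)
  have "(\<lambda>k. (- fps_X - fps_const (of_nat m)) $ k * s ^ k) sums (- s - of_nat m)"
    using sums_finite[of "{0, 1}" "\<lambda>k. (- fps_X - fps_const (of_nat m)) $ k * s ^ k"]
    by (simp add: algebra_simps)
  from fps_sums_padic_mult[OF Suc this] show ?case
    by (simp add: falling_fps_def)
qed

text \<open>Every term of a linear factor is at most \<open>max 1 \<bar>s\<bar>\<^sub>p\<close>, and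
  term bounds multiply.\<close>

lemma padic_abs_falling_fps_le: "\<bar>falling_fps m $ k * s ^ k\<bar>\<^sub>p \<le> max 1 \<bar>s\<bar>\<^sub>p ^ m"
proof (induction m arbitrary: k)
  case 0
  then show ?case
    by (cases k) (auto simp: falling_fps_def)
next
  case (Suc m)
  have "\<bar>(- fps_X - fps_const (of_nat m)) $ j * s ^ j\<bar>\<^sub>p \<le> max 1 \<bar>s\<bar>\<^sub>p" for j
    using padic_abs_of_nat_le[of m] by (cases "j = 0"; cases "j = 1") auto
  from padic_abs_fps_mult_le[OF Suc this] show ?case
    by (simp add: falling_fps_def mult.commute)
qed

text \<open>Rows of the array are the summands \<open>l_term\<close>, and columns collect a fixed
  power of \<open>s\<close>. The row bound is geometric with ratio
  \<open>rate * max 1 \<bar>s\<bar>\<^sub>p\<close>, below 1 because both 1 and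
  \<open>\<bar>s\<bar>\<^sub>p\<close> lie below \<open>radius_D p\<close>.\<close>

lemma
  fixes s :: 'a
  assumes "\<not> p dvd A" "p dvd F"
  shows summable_l_term: "\<bar>s\<bar>\<^sub>p < radius_D p \<Longrightarrow> summable (l_term r F A s)"
    and analytic_on_disc_l_term: "analytic_on_disc (\<lambda>s :: 'a. \<Sum>m. l_term r F A s m) (radius_D p)"
proof -
  define t :: "nat \<Rightarrow> 'a"
    where "t m = (of_nat F / of_nat A) ^ m * of_rat (euler_number r m) * (1 / fact m)" for m
  have "\<bar>of_nat F / of_nat A :: 'a\<bar>\<^sub>p \<le> 1 / real p"
    using assms padic_abs_of_int_dvd_le[of 1 "int F"]
    by (simp add: padic_abs_divide padic_abs_of_nat_eq_1)
  then have t: "\<bar>t m\<bar>\<^sub>p \<le> rate ^ m" for m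
  proof -
    have "\<bar>t m\<bar>\<^sub>p \<le> (1 / real p) ^ m * 1 * root_p ^ m"
      unfolding t_def padic_abs_mult padic_abs_power
      using \<open>\<bar>of_nat F / of_nat A :: 'a\<bar>\<^sub>p \<le> 1 / real p\<close> padic_abs_euler_number_le padic_abs_inverse_fact_le
      by (intro mult_mono power_mono mult_nonneg_nonneg) auto
    then show ?thesis
      by (simp add: rate_def power_divide)
  qed
  have l_term: "l_term r F A s m = t m * (\<Prod>i<m. - s - of_nat i)" for m and s :: 'a
    by (simp add: l_term_def t_def gbinomial_prod_rev atLeast0LessThan)
  have row: "(\<lambda>k. t m * (falling_fps m $ k * s ^ k)) sums l_term r F A s m" for m and s :: 'a
    unfolding l_term by (intro sums_padic_cmult falling_fps_sums)
  have le: "\<bar>t m * (falling_fps m $ k * s ^ k)\<bar>\<^sub>p \<le> (rate * max 1 \<bar>s\<bar>\<^sub>p) ^ m" for m k and s :: 'a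
    unfolding padic_abs_mult[of "t m"] power_mult_distrib
    using t padic_abs_falling_fps_le rate_pos by (intro mult_mono) auto
  have lim: "(\<lambda>m. (rate * max 1 \<bar>s\<bar>\<^sub>p) ^ m) \<longlonglongrightarrow> 0" if "\<bar>s\<bar>\<^sub>p < radius_D p" for s :: 'a
  proof (rule LIMSEQ_power_zero)
    have "rate * max 1 \<bar>s\<bar>\<^sub>p < rate * radius_D p"
      using that radius_D_gt_1 rate_pos by (intro mult_strict_left_mono) auto
    then show "norm (rate * max 1 \<bar>s\<bar>\<^sub>p) < 1"
      using rate_pos radius_D_rate by (simp add: mult.commute abs_mult)
  qed
  \<comment> \<open>The coefficients of the final power series must not depend on \<open>s\<close>,
    so their convergence is read off at \<open>s = 1\<close>, a point of the disc.\<close>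
  have column: "summable (\<lambda>m. t m * falling_fps m $ k)" for k
  proof (rule summable_padic[OF real_null_squeeze])
    show "\<bar>t m * falling_fps m $ k\<bar>\<^sub>p \<le> (rate * max 1 \<bar>1 :: 'a\<bar>\<^sub>p) ^ m" for m
      using le[of m k 1] by simp
    show "(\<lambda>m. (rate * max 1 \<bar>1 :: 'a\<bar>\<^sub>p) ^ m) \<longlonglongrightarrow> 0"
      using radius_D_gt_1 by (intro lim) simp
  qed simp
  have main: "\<exists>L. l_term r F A s sums L \<and> (\<lambda>k. (\<Sum>m. t m * falling_fps m $ k) * s ^ k) sums L"
    if s: "\<bar>s\<bar>\<^sub>p < radius_D p" for s :: 'a
  proof -
    let ?a = "\<lambda>m k. t m * (falling_fps m $ k * s ^ k)"
    have null: "\<exists>N. \<forall>i j. N \<le> i \<or> N \<le> j \<longrightarrow> \<bar>?a i j\<bar>\<^sub>p < e" if "0 < e" for e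
    proof (rule double_null_criterion[OF lim[OF s] le _ that])
      show "(\<lambda>k. \<bar>?a m k\<bar>\<^sub>p) \<longlonglongrightarrow> 0" for m
        by (rule summable_padic_tendsto_0[OF sums_summable[OF row]])
    qed
    have col: "(\<lambda>m. ?a m k) sums ((\<Sum>m. t m * falling_fps m $ k) * s ^ k)" for k
      using sums_padic_cmult[OF summable_sums[OF column[of k]], of "s ^ k"] by (simp add: mult_ac)
    obtain L where "l_term r F A s sums L" "(\<lambda>k. (\<Sum>m. t m * falling_fps m $ k) * s ^ k) sums L"
      by (rule sums_padic_swap[OF null row col])
    then show ?thesis
      by blast
  qed
  then show "\<bar>s\<bar>\<^sub>p < radius_D p \<Longrightarrow> summable (l_term r F A s)"
    by (auto simp: summable_def)
  show "analytic_on_disc (\<lambda>s :: 'a. \<Sum>m. l_term r F A s m) (radius_D p)"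
    unfolding analytic_on_disc_def
  proof (intro exI allI impI)
    fix s :: 'a assume "\<bar>s\<bar>\<^sub>p < radius_D p"
    from main[OF this] obtain L
      where "l_term r F A s sums L" "(\<lambda>k. (\<Sum>m. t m * falling_fps m $ k) * s ^ k) sums L"
      by blast
    then show "(\<lambda>k. (\<Sum>m. t m * falling_fps m $ k) * s ^ k) sums (\<Sum>m. l_term r F A s m)"
      using sums_unique by blast
  qed
qed

lemma analytic_on_disc_l_function:
  fixes chi :: "int \<Rightarrow> 'a"
  assumes "p dvd F"
  shows "analytic_on_disc (l_function p r F chi) (radius_D p)"
proof -
  have "l_function p r F chi = (\<lambda>s. \<Sum>a\<in>{a \<in> tuples r F. \<not> p dvd (\<Sum>i<r. a i)}.
      (chi (int (\<Sum>i<r. a i)) * (-1) ^ (\<Sum>i<r. a i)) *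
      (angle_pow p (int (\<Sum>i<r. a i)) (- s) * (\<Sum>m. l_term r F (\<Sum>i<r. a i) s m)))"
    by (simp add: l_function_def Let_def mult_ac fun_eq_iff del: of_nat_sum)
  then show ?thesis
    using assms
    by (auto intro!: analytic_on_disc_sum analytic_on_disc_cmult analytic_on_disc_mult
        analytic_on_disc_angle_pow analytic_on_disc_l_term simp del: of_nat_sum)
qed

section \<open>Values at \<open>s = - n\<close>\<close>

lemma angle_pow_l_term_of_nat:
  assumes A: "\<not> p dvd A" and F: "F > 0"
  shows "angle_pow p (int A) (of_nat n) * (\<Sum>m. l_term r F A (- of_nat n) m) =
    teichmueller p (int A) powi (- int n) * (of_nat F ^ n * of_rat (euler_polynomial r n (of_nat A / of_nat F)) :: 'a)"
proof -
  have "A > 0"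
    using A by (intro gr0I) auto
  have "\<not> int p dvd int A"
    using A by simp
  have l_term: "l_term r F A (- of_nat n :: 'a) m =
      of_nat (n choose m) * (of_nat F / of_nat A) ^ m * of_rat (euler_number r m)" for m
    by (simp add: l_term_def binomial_gbinomial)
  have "(l_term r F A (- of_nat n :: 'a)) sums (\<Sum>m=0..n. l_term r F A (- of_nat n) m)"
    by (rule sums_finite) (auto simp: l_term)
  then have "(\<Sum>m. l_term r F A (- of_nat n :: 'a) m) =
      (\<Sum>m=0..n. of_nat (n choose m) * (of_nat F / of_nat A) ^ m * of_rat (euler_number r m))"
    unfolding l_term by (simp add: sums_unique[symmetric])
  moreover have "angle_pow p (int A) (of_nat n) = teichmueller p (int A) powi (- int n) * (of_nat A ^ n :: 'a)"
    using angle_pow_of_nat[OF \<open>\<not> int p dvd int A\<close>]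
    by (simp add: angle_def power_divide power_int_minus divide_inverse power_mult_distrib power_inverse mult.commute)
  ultimately show ?thesis
    unfolding euler_polynomial_homogeneous[OF \<open>A > 0\<close> F] by (simp add: mult.assoc)
qed

text \<open>For \<open>A = p * B\<close> the sign is unchanged because \<open>p\<close> is odd, and
  \<open>p ^ n\<close> restores \<open>F ^ n\<close> from \<open>(F / p) ^ n\<close>. Thus the
  starred term accounts for precisely the tuples with \<open>p\<close> dividing
  \<open>A\<close>.\<close>

lemma l_function_interpolation:
  fixes chi :: "int \<Rightarrow> 'a"
  assumes chi: "primitive_character f chi" and F: "F > 0" "p dvd F"
  shows "l_function p r F chi (- of_nat n) =
    generalized_euler r F n (twist p f chi (int n)) -
    of_nat p ^ n * twist p f chi (int n) (int p) *
      generalized_euler_star p r F n (twist p f chi (int n))"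
proof -
  let ?psi = "twist p f chi (int n)"
  let ?A = "\<lambda>a :: nat \<Rightarrow> nat. \<Sum>i<r. a i"
  define T where "T A = ?psi (int A) * (-1) ^ A *
    (of_nat F ^ n * of_rat (euler_polynomial r n (of_nat A / of_nat F)))" for A
  have fin: "finite (tuples r F)"
    by (simp add: tuples_def finite_PiE)
  have l: "l_function p r F chi (- of_nat n) = (\<Sum>a\<in>{a \<in> tuples r F. \<not> p dvd ?A a}. T (?A a))"
    unfolding l_function_def Let_def
  proof (rule sum.cong)
    fix a assume "a \<in> {a \<in> tuples r F. \<not> p dvd ?A a}"
    then have a: "\<not> p dvd ?A a"
      by simp
    then have "\<not> int p dvd int (?A a)"
      by (simp only: int_dvd_int_iff) simp
    then have "?psi (int (?A a)) = chi (int (?A a)) * teichmueller p (int (?A a)) powi (- int n)"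
      by (rule twist_eq[OF chi])
    then show "chi (int (?A a)) * angle_pow p (int (?A a)) (- (- of_nat n)) * (-1) ^ ?A a *
        (\<Sum>m. l_term r F (?A a) (- of_nat n) m) = T (?A a)"
      using angle_pow_l_term_of_nat[OF a F(1), of n r]
      by (simp add: T_def mult_ac del: of_nat_sum)
  qed simp
  have star: "of_nat p ^ n * ?psi (int p) * generalized_euler_star p r F n ?psi =
      (\<Sum>a\<in>{a \<in> tuples r F. p dvd ?A a}. T (?A a))"
    unfolding generalized_euler_star_def Let_def sum_distrib_left
  proof (rule sum.cong)
    fix a assume "a \<in> {a \<in> tuples r F. p dvd ?A a}"
    then obtain B where B: "?A a = p * B"
      by (auto elim: dvdE)
    have "p > 0"
      using p_ge_3 by simp
    have "(-1 :: 'a) ^ (p * B) = (-1) ^ B"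
      using odd_p by (simp add: power_mult)
    moreover have "of_nat (p * B) / of_nat F = (of_nat (p * B) / of_nat p) / (of_nat F / of_nat p :: rat)"
      using \<open>p > 0\<close> by simp
    moreover have "?psi (int (p * B)) = ?psi (int p) * ?psi (int B)"
      by (simp add: twist_mult[OF chi])
    moreover have "of_nat p ^ n * (of_nat F / of_nat p) ^ n = (of_nat F ^ n :: 'a)"
      using \<open>p > 0\<close> by (simp add: power_divide)
    ultimately show "of_nat p ^ n * ?psi (int p) * ((of_nat F / of_nat p) ^ n *
        (?psi (int (?A a div p)) * (-1) ^ (?A a div p) *
        of_rat (euler_polynomial r n (of_nat (?A a) / of_nat p / (of_nat F / of_nat p))))) = T (?A a)"
      using \<open>p > 0\<close> unfolding T_def B by (simp add: mult_ac)
  qed simp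
  have "generalized_euler r F n ?psi = (\<Sum>a\<in>tuples r F. T (?A a))"
    unfolding generalized_euler_def Let_def T_def sum_distrib_left by (simp add: mult_ac)
  also have "tuples r F = {a \<in> tuples r F. \<not> p dvd ?A a} \<union> {a \<in> tuples r F. p dvd ?A a}"
    by auto
  also have "(\<Sum>a\<in>\<dots>. T (?A a)) =
      (\<Sum>a\<in>{a \<in> tuples r F. \<not> p dvd ?A a}. T (?A a)) + (\<Sum>a\<in>{a \<in> tuples r F. p dvd ?A a}. T (?A a))"
    using fin by (intro sum.union_disjoint) auto
  finally show ?thesis
    unfolding l star by simp
qed

end

text \<open>Convergence of the inner series is part of the conclusion because \<open>suminf\<close>
  also denotes some value when a series diverges.\<close>

theorem theorem1:
  fixes p r f F :: nat
    and chi :: "int \<Rightarrow> 'a::{field_char_0,complete_space}"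
  assumes "prime p" and "odd p"
    and "is_padic_complex TYPE('a) p"
    and "primitive_character f chi" and "odd f"
    and "F > 0" and "odd F" and "p dvd F" and "f dvd F"
  shows "(\<forall>s::'a. padic_abs s < radius_D p \<longrightarrow>
            (\<forall>a\<in>tuples r F. \<not> p dvd (\<Sum>i<r. a i) \<longrightarrow> summable (l_term r F (\<Sum>i<r. a i) s))) \<and>
         analytic_on_disc (l_function p r F chi) (radius_D p) \<and>
         (\<forall>n::nat. l_function p r F chi (- of_nat n) =
            generalized_euler r F n (twist p f chi (int n)) -
            of_nat p ^ n * twist p f chi (int n) (int p) *
              generalized_euler_star p r F n (twist p f chi (int n)))"
proof -
  interpret padic_field "TYPE('a)" p
    using assms(1-3) unfolding is_padic_complex_def by unfold_locales auto
  show ?thesis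
    using summable_l_term[OF _ \<open>p dvd F\<close>] analytic_on_disc_l_function[OF \<open>p dvd F\<close>]
      l_function_interpolation[OF assms(4,6,8)]
    by (intro conjI allI impI ballI) assumption+
qed

end
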